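(* Let $n\ge1$ and let $X\subset\mathbb{C}^n$ be a closed pure $(n-1)$-dimensional complex analytic set. Then either $X$ is algebraic or $\Sigma_\infty(X)=\mathbb{P}^{n-1}(\mathbb{C})$. Equivalently, if $\Sigma_\infty(X)\neq\mathbb{P}^{n-1}(\mathbb{C})$, then $X$ is algebraic.
   Context: A closed pure $d$-dimensional complex analytic set $X\subset\mathbb{C}^n$ is a nonempty closed complex analytic subset having dimension $d$ at each of its points. $X$ is algebraic if it is the common zero set of a family of polynomials in $\mathbb{C}[z_1,\dots,z_n]$. For $A\subset\mathbb{C}^n$, the total tangent cone at infinity is $$C_\infty(A)=\{v\in\mathbb{C}^n:\exists\, x_j\in A,\ t_j>0,\ \|x_j\|\to\infty,\ t_j\to\infty,\ x_j/t_j\to v\}.$$ The projective asymptotic direction set is $\Sigma_\infty(A)=\{\mathbb{C}v: v\in C_\infty(A)\setminus\{0\}\}\subset\mathbb{P}^{n-1}(\mathbb{C})$, where $\mathbb{P}^{n-1}(\mathbb{C})$ is the space of complex lines through the origin in $\mathbb{C}^n$. The "either ... or" is inclusive: at least one of the two alternatives holds. *)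

theory Defs
  imports "HOL-Analysis.Analysis" "HOL-Library.Poly_Mapping"
begin

text \<open>Complex \<open>n\<close>-space is \<open>complex ^ 'n\<close> with \<open>n = CARD('n) \<ge> 1\<close>; complex scalar multiplication
  is \<open>*s\<close>, and \<open>vec.span\<close> is the span over the complex numbers.\<close>

definition holomorphic_fun_on :: "(complex ^ 'n \<Rightarrow> complex) \<Rightarrow> (complex ^ 'n) set \<Rightarrow> bool" where
  "holomorphic_fun_on f U \<longleftrightarrow> open U \<and>
     (\<forall>z\<in>U. \<exists>f'. (f has_derivative f') (at z) \<and> (\<forall>c v. f' (c *s v) = c * f' v))"

definition holomorphic_map_on :: "(complex ^ 'n \<Rightarrow> complex ^ 'm) \<Rightarrow> (complex ^ 'n) set \<Rightarrow> bool" where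
  "holomorphic_map_on f U \<longleftrightarrow> (\<forall>i. holomorphic_fun_on (\<lambda>z. f z $ i) U)"

definition analytic_subset :: "(complex ^ 'n) set \<Rightarrow> bool" where
  "analytic_subset X \<longleftrightarrow>
     (\<forall>p. \<exists>U F. open U \<and> p \<in> U \<and> finite F \<and> (\<forall>f\<in>F. holomorphic_fun_on f U) \<and>
            X \<inter> U = {z \<in> U. \<forall>f\<in>F. f z = 0})"

text \<open>\<open>q\<close> is a regular point of dimension \<open>k\<close>: near \<open>q\<close>, the set \<open>X\<close> is a \<open>k\<close>-dimensional complex
  submanifold, i.e. a biholomorphic chart straightens it to a coordinate subspace.\<close>

definition regular_point :: "nat \<Rightarrow> (complex ^ 'n) set \<Rightarrow> complex ^ 'n \<Rightarrow> bool" where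
  "regular_point k X q \<longleftrightarrow> q \<in> X \<and>
     (\<exists>U V \<phi> \<psi>. \<exists>I :: 'n set. open U \<and> q \<in> U \<and> open V \<and> homeomorphism U V \<phi> \<psi> \<and>
        holomorphic_map_on \<phi> U \<and> holomorphic_map_on \<psi> V \<and> card I = k \<and>
        \<phi> ` (X \<inter> U) = {w \<in> V. \<forall>i. i \<notin> I \<longrightarrow> w $ i = 0})"

text \<open>The dimension of an analytic set at \<open>p\<close> is the upper limit, as \<open>q\<close> tends to \<open>p\<close> through the
  regular points, of the dimension at \<open>q\<close>: the largest \<open>k\<close> such that regular points of dimension
  \<open>k\<close> accumulate at (or include) \<open>p\<close>. It is a relation because the set of such \<open>k\<close> could be
  empty if \<open>X\<close> were not analytic.\<close>

definition regular_dims_near :: "(complex ^ 'n) set \<Rightarrow> complex ^ 'n \<Rightarrow> nat set" where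
  "regular_dims_near X p = {k. \<forall>U. open U \<and> p \<in> U \<longrightarrow> (\<exists>q\<in>U. regular_point k X q)}"

definition has_dimension_at :: "(complex ^ 'n) set \<Rightarrow> complex ^ 'n \<Rightarrow> nat \<Rightarrow> bool" where
  "has_dimension_at X p d \<longleftrightarrow>
     d \<in> regular_dims_near X p \<and> (\<forall>k\<in>regular_dims_near X p. k \<le> d)"

definition closed_pure_dim_analytic :: "nat \<Rightarrow> (complex ^ 'n) set \<Rightarrow> bool" where
  "closed_pure_dim_analytic d X \<longleftrightarrow>
     X \<noteq> {} \<and> closed X \<and> analytic_subset X \<and> (\<forall>p\<in>X. has_dimension_at X p d)"

text \<open>The polynomial ring in the variables \<open>'n\<close> is the monoid algebra of the exponent vectors
  \<open>'n \<Rightarrow>\<^sub>0 nat\<close>.\<close>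

definition mpoly_eval :: "(('n \<Rightarrow>\<^sub>0 nat) \<Rightarrow>\<^sub>0 complex) \<Rightarrow> complex ^ 'n \<Rightarrow> complex" where
  "mpoly_eval P z =
     (\<Sum>m\<in>Poly_Mapping.keys P.
        Poly_Mapping.lookup P m * (\<Prod>i\<in>UNIV. (z $ i) ^ Poly_Mapping.lookup m i))"

definition algebraic_subset :: "(complex ^ 'n) set \<Rightarrow> bool" where
  "algebraic_subset X \<longleftrightarrow>
     (\<exists>S :: (('n \<Rightarrow>\<^sub>0 nat) \<Rightarrow>\<^sub>0 complex) set. X = {z. \<forall>P\<in>S. mpoly_eval P z = 0})"

definition tangent_cone_infinity :: "(complex ^ 'n) set \<Rightarrow> (complex ^ 'n) set" where
  "tangent_cone_infinity A =
     {v. \<exists>(x :: nat \<Rightarrow> complex ^ 'n) (t :: nat \<Rightarrow> real).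
           (\<forall>j. x j \<in> A) \<and> (\<forall>j. t j > 0) \<and>
           filterlim (\<lambda>j. norm (x j)) at_top sequentially \<and>
           filterlim t at_top sequentially \<and>
           (\<lambda>j. x j /\<^sub>R t j) \<longlonglongrightarrow> v}"

definition projective_space :: "(complex ^ 'n) set set" where
  "projective_space = {vec.span {v} | v. v \<noteq> 0}"

definition asymptotic_directions :: "(complex ^ 'n) set \<Rightarrow> (complex ^ 'n) set set" where
  "asymptotic_directions A = {vec.span {v} | v. v \<in> tangent_cone_infinity A - {0}}"

end

theory Submission
  imports Defs "HOL-Complex_Analysis.Complex_Analysis"
begin

text \<open>If the line spanned by \<open>v\<close> is not an asymptotic direction of \<open>X\<close>, the fibres
  \<open>F z = {w. z + w v \<in> X}\<close> satisfy \<open>|w| \<le> C (1 + |z|)\<close>, so they are compact analytic subsets of the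
  complex plane, hence finite. Locally \<open>X\<close> lies in the zero set of a holomorphic function that has
  finitely many zeros on each vertical disc; off the zero set of a discriminant these zeros are
  holomorphic functions of \<open>z\<close>, and purity forces \<open>X\<close> to be a union of some of these sheets. There
  \<open>g z = \<Prod>w\<in>F z. w\<close> is holomorphic and bounded, and Riemann's extension theorem makes it an entire
  function with zero set \<open>X\<close>. The bound on the fibres gives \<open>g\<close> polynomial growth, so \<open>g\<close> is a
  polynomial.\<close>

subsection \<open>Complex lines\<close>

text \<open>The fibre \<open>F z\<close> is taken over every point \<open>z\<close> of the space
  rather than over a hyperplane transverse to \<open>v\<close>. This avoids a linear change of
  coordinates, and since \<open>0\<close> lies in \<open>F z\<close> exactly when \<open>z\<close>
  lies in \<open>X\<close>, the product itself is the defining function: on a generic line in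
  direction \<open>v\<close> it is, up to sign, the monic polynomial whose simple roots are the
  points of \<open>X\<close> on that line. The obstacle is that analyticity supplies several local
  equations and no single generator. One equation that is not identically zero on the vertical line
  confines \<open>X\<close> to finitely many sheets, but it may have further sheets and repeated
  zeros. So its zeros are counted without multiplicity, by a discriminant adapted to the generic
  number of distinct zeros, and the sheets belonging to \<open>X\<close> must be singled out. Over
  the zero set of the discriminant the fibre may have fewer points, and the product over it need not
  be the value of the extension. There \<open>X = {z. g z = 0}\<close> is recovered from nearby
  generic fibres: a point of \<open>X\<close> forces small factors, a point outside \<open>X\<close>
  keeps all factors away from \<open>0\<close>.\<close>

lemma norm_smult: "norm (c *s x) = norm c * norm (x :: complex ^ 'n)"
  by (simp add: norm_vec_def norm_mult L2_set_right_distrib)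

text \<open>Source of the continuity, limit and derivative rules for the complex scaling
  \<open>*s\<close>.\<close>

lemma bounded_bilinear_smult: "bounded_bilinear (\<lambda>c x. c *s (x :: complex ^ 'n))"
proof
  show "\<exists>K. \<forall>a b. norm (a *s (b :: complex ^ 'n)) \<le> norm a * norm b * K"
    by (rule exI[of _ 1]) (simp add: norm_smult)
qed (vector algebra_simps)+

lemma continuous_on_smult [continuous_intros]:
  assumes "continuous_on S f" "continuous_on S g"
  shows "continuous_on S (\<lambda>x. f x *s (g x :: complex ^ 'n))"
  by (rule bounded_bilinear.continuous_on[OF bounded_bilinear_smult assms])

lemma open_line_vimage:
  fixes U :: "(complex ^ 'n) set"
  assumes "open U"
  shows "open {t. z + t *s u \<in> U}"
proof -
  have "continuous_on UNIV (\<lambda>t. z + t *s u)"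
    by (intro continuous_intros)
  from open_vimage[OF assms this] show ?thesis
    by (simp add: vimage_def)
qed

lemma convex_line_vimage:
  fixes U :: "(complex ^ 'n) set"
  assumes "convex U"
  shows "convex {t. z + t *s u \<in> U}"
proof (rule convexI, clarify)
  fix x y and a b :: real
  assume xy: "z + x *s u \<in> U" "z + y *s u \<in> U" and ab: "0 \<le> a" "0 \<le> b" "a + b = 1"
  have "z + (a *\<^sub>R x + b *\<^sub>R y) *s u = a *\<^sub>R (z + x *s u) + b *\<^sub>R (z + y *s u)"
  proof (subst vec_eq_iff, clarify)
    fix i
    have "z $ i = (of_real a + of_real b) * z $ i"
      using ab by (simp flip: of_real_add)
    then show "(z + (a *\<^sub>R x + b *\<^sub>R y) *s u) $ i = (a *\<^sub>R (z + x *s u) + b *\<^sub>R (z + y *s u)) $ i"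
      by (simp add: scaleR_conv_of_real[where 'a = complex] algebra_simps)
  qed
  also have "\<dots> \<in> U"
    using assms xy ab by (intro convexD)
  finally show "z + (a *\<^sub>R x + b *\<^sub>R y) *s u \<in> U" .
qed

text \<open>The compact image of \<open>K\<close> has a uniform neighbourhood inside
  \<open>U\<close>, and replacing \<open>b\<close> by \<open>z\<close> moves all of its points by
  the same vector. This is what allows one fixed contour to serve all nearby base points.\<close>

lemma line_tube:
  fixes b v :: "complex ^ 'n"
  assumes "open U" "compact K" "\<And>w. w \<in> K \<Longrightarrow> b + w *s v \<in> U"
  obtains r where "r > 0" "\<And>z w. z \<in> ball b r \<Longrightarrow> w \<in> K \<Longrightarrow> z + w *s v \<in> U"
proof -
  have "compact ((\<lambda>w. b + w *s v) ` K)"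
    by (intro compact_continuous_image continuous_intros assms)
  then obtain r where r: "r > 0" "(\<Union>x\<in>(\<lambda>w. b + w *s v) ` K. ball x r) \<subseteq> U"
    using compact_subset_open_imp_ball_epsilon_subset[of "(\<lambda>w. b + w *s v) ` K" U] assms by blast
  show ?thesis
  proof
    fix z w assume "z \<in> ball b r" "w \<in> K"
    then have "z + w *s v \<in> ball (b + w *s v) r"
      by (simp add: dist_norm)
    with r \<open>w \<in> K\<close> show "z + w *s v \<in> U"
      by blast
  qed (use r in auto)
qed

subsection \<open>Line-holomorphic functions\<close>

text \<open>By Osgood's lemma this is the same as holomorphic; stated along lines, it lets every argument
  reduce to one-variable function theory.\<close>

definition line_holomorphic_on :: "(complex ^ 'n \<Rightarrow> complex) \<Rightarrow> (complex ^ 'n) set \<Rightarrow> bool" where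
  "line_holomorphic_on f U \<longleftrightarrow> open U \<and> continuous_on U f \<and>
     (\<forall>z u. (\<lambda>t. f (z + t *s u)) holomorphic_on {t. z + t *s u \<in> U})"

lemma line_holomorphic_onD:
  assumes "line_holomorphic_on f U"
  shows "open U" "continuous_on U f" "(\<lambda>t. f (z + t *s u)) holomorphic_on {t. z + t *s u \<in> U}"
  using assms by (auto simp: line_holomorphic_on_def)

lemma line_holomorphic_on_subset:
  assumes "line_holomorphic_on f U" "open V" "V \<subseteq> U"
  shows "line_holomorphic_on f V"
  using assms unfolding line_holomorphic_on_def
  by (auto intro: continuous_on_subset holomorphic_on_subset)

lemma line_holomorphic_on_cong:
  assumes "line_holomorphic_on f U" "\<And>z. z \<in> U \<Longrightarrow> f z = g z"
  shows "line_holomorphic_on g U"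
  unfolding line_holomorphic_on_def
proof (intro conjI allI)
  show "open U" "continuous_on U g"
    using line_holomorphic_onD(1,2)[OF assms(1)] assms(2) by (auto cong: continuous_on_cong)
  show "(\<lambda>t. g (z + t *s u)) holomorphic_on {t. z + t *s u \<in> U}" for z u
    by (rule holomorphic_transform[OF line_holomorphic_onD(3)[OF assms(1)]]) (simp add: assms(2))
qed

lemma line_holomorphic_on_const: "open U \<Longrightarrow> line_holomorphic_on (\<lambda>_. c) U"
  by (simp add: line_holomorphic_on_def)

lemma line_holomorphic_on_diff:
  assumes "line_holomorphic_on f U" "line_holomorphic_on g U"
  shows "line_holomorphic_on (\<lambda>z. f z - g z) U"
  using assms unfolding line_holomorphic_on_def
  by (auto intro!: continuous_intros holomorphic_intros)

lemma line_holomorphic_on_mult: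
  assumes "line_holomorphic_on f U" "line_holomorphic_on g U"
  shows "line_holomorphic_on (\<lambda>z. f z * g z) U"
  using assms unfolding line_holomorphic_on_def
  by (auto intro!: continuous_intros holomorphic_intros)

lemma line_holomorphic_on_divide:
  assumes "line_holomorphic_on f U" "line_holomorphic_on g U" "\<And>z. z \<in> U \<Longrightarrow> g z \<noteq> 0"
  shows "line_holomorphic_on (\<lambda>z. f z / g z) U"
  using assms unfolding line_holomorphic_on_def
  by (auto intro!: continuous_intros holomorphic_intros)

lemma line_holomorphic_on_prod:
  assumes "open U" "\<And>i. i \<in> I \<Longrightarrow> line_holomorphic_on (f i) U"
  shows "line_holomorphic_on (\<lambda>z. \<Prod>i\<in>I. f i z) U"
  using assms unfolding line_holomorphic_on_def
  by (auto intro!: continuous_intros holomorphic_intros)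

lemma line_holomorphic_on_translate:
  assumes "line_holomorphic_on f U" "open V" "\<And>z. z \<in> V \<Longrightarrow> z + c \<in> U"
  shows "line_holomorphic_on (\<lambda>z. f (z + c)) V"
  unfolding line_holomorphic_on_def
proof (intro conjI allI)
  show "continuous_on V (\<lambda>z. f (z + c))"
    by (rule continuous_on_compose2[OF line_holomorphic_onD(2)[OF assms(1)]])
      (use assms in \<open>auto intro!: continuous_intros\<close>)
  fix z u
  have "(\<lambda>t. f ((z + c) + t *s u)) holomorphic_on {t. z + t *s u \<in> V}"
    by (rule holomorphic_on_subset[OF line_holomorphic_onD(3)[OF assms(1)]])
      (use assms(3) in \<open>force simp: algebra_simps\<close>)
  then show "(\<lambda>t. f (z + t *s u + c)) holomorphic_on {t. z + t *s u \<in> V}"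
    by (simp add: algebra_simps)
qed (fact assms)

lemma line_holomorphic_on_local:
  assumes "open U" "\<And>z. z \<in> U \<Longrightarrow> \<exists>V. z \<in> V \<and> line_holomorphic_on f V"
  shows "line_holomorphic_on f U"
  unfolding line_holomorphic_on_def
proof (intro conjI allI)
  show "continuous_on U f"
  proof (rule continuous_at_imp_continuous_on, rule ballI)
    fix z assume "z \<in> U"
    with assms(2) obtain V where "z \<in> V" "line_holomorphic_on f V"
      by blast
    then show "isCont f z"
      using line_holomorphic_onD(1,2)[of f V] continuous_on_eq_continuous_at by blast
  qed
  fix z u
  show "(\<lambda>t. f (z + t *s u)) holomorphic_on {t. z + t *s u \<in> U}"
  proof (subst holomorphic_on_open)
    show "open {t. z + t *s u \<in> U}"
      by (rule open_line_vimage) fact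
    show "\<forall>t\<in>{t. z + t *s u \<in> U}. \<exists>f'. ((\<lambda>t. f (z + t *s u)) has_field_derivative f') (at t)"
    proof clarify
      fix t assume "z + t *s u \<in> U"
      with assms(2) obtain V where V: "z + t *s u \<in> V" "line_holomorphic_on f V"
        by blast
      have "open {t. z + t *s u \<in> V}"
        by (rule open_line_vimage) (use V line_holomorphic_onD in blast)
      with line_holomorphic_onD(3)[OF V(2), of z u] V(1)
      show "\<exists>f'. ((\<lambda>t. f (z + t *s u)) has_field_derivative f') (at t)"
        by (simp add: holomorphic_on_open)
    qed
  qed
qed (fact assms)

text \<open>The path in question is a curve and not a line, so the chain rule is applied to the
  complex-linear derivative of \<open>f\<close>, which line-holomorphy does not directly provide.
  The lemma serves to restrict an equation of \<open>X\<close> to a sheet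
  \<open>w = \<alpha> z\<close>.\<close>

lemma line_holomorphic_on_compose_graph:
  fixes f :: "complex ^ 'n \<Rightarrow> complex"
  assumes f: "holomorphic_fun_on f U" and \<alpha>: "line_holomorphic_on \<alpha> V"
    and sub: "\<And>z. z \<in> V \<Longrightarrow> z + \<alpha> z *s v \<in> U"
  shows "line_holomorphic_on (\<lambda>z. f (z + \<alpha> z *s v)) V"
  unfolding line_holomorphic_on_def
proof (intro conjI allI)
  note V = line_holomorphic_onD[OF \<alpha>]
  show "open V" by (fact V)
  have "continuous_on U f"
    using f unfolding holomorphic_fun_on_def
    by (meson continuous_at_imp_continuous_on has_derivative_continuous)
  then show "continuous_on V (\<lambda>z. f (z + \<alpha> z *s v))"
    by (rule continuous_on_compose2) (use sub V in \<open>auto intro!: continuous_intros\<close>)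
  fix z u
  show "(\<lambda>t. f (z + t *s u + \<alpha> (z + t *s u) *s v)) holomorphic_on {t. z + t *s u \<in> V}"
  proof (subst holomorphic_on_open)
    show "open {t. z + t *s u \<in> V}"
      by (rule open_line_vimage) (fact V)
    show "\<forall>t\<in>{t. z + t *s u \<in> V}. \<exists>f'. ((\<lambda>t. f (z + t *s u + \<alpha> (z + t *s u) *s v)) has_field_derivative f') (at t)"
    proof clarify
      fix t assume t: "z + t *s u \<in> V"
      let ?c = "\<lambda>t. z + t *s u + \<alpha> (z + t *s u) *s v"
      obtain f' where f': "(f has_derivative f') (at (?c t))" "\<And>c v. f' (c *s v) = c * f' v"
        using f sub[OF t] unfolding holomorphic_fun_on_def by blast
      obtain a' where "((\<lambda>t. \<alpha> (z + t *s u)) has_field_derivative a') (at t)"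
        using V(3)[of z u] t open_line_vimage[OF V(1)] by (auto simp: holomorphic_on_open)
      then have a': "((\<lambda>t. \<alpha> (z + t *s u)) has_derivative (\<lambda>h. a' * h)) (at t)"
        by (simp add: has_field_derivative_def)
      have "(?c has_derivative (\<lambda>h. 0 + (t *s 0 + h *s u) + (\<alpha> (z + t *s u) *s 0 + (a' * h) *s v))) (at t)"
        by (intro has_derivative_add has_derivative_const a' has_derivative_ident
            bounded_bilinear.FDERIV[OF bounded_bilinear_smult])
      then have "(?c has_derivative (\<lambda>h. h *s (u + a' *s v))) (at t)"
        by (simp add: vector_add_ldistrib vector_smult_assoc mult.commute)
      from has_derivative_compose[OF this f'(1)]
      have "((\<lambda>t. f (?c t)) has_derivative (\<lambda>h. f' (u + a' *s v) * h)) (at t)"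
        by (simp only: f'(2) mult.commute)
      then show "\<exists>f'. ((\<lambda>t. f (?c t)) has_field_derivative f') (at t)"
        unfolding has_field_derivative_def by blast
    qed
  qed
qed

lemma holomorphic_imp_line_holomorphic:
  assumes "holomorphic_fun_on f U"
  shows "line_holomorphic_on f U"
  using line_holomorphic_on_compose_graph[OF assms line_holomorphic_on_const, of U 0 0] assms
  by (simp add: holomorphic_fun_on_def)

subsection \<open>Contour integrals depending on a parameter\<close>

lemma continuous_on_contour_integral_param:
  fixes \<psi> :: "'a::topological_space \<Rightarrow> complex \<Rightarrow> complex"
  assumes "continuous_on (\<Omega> \<times> path_image \<gamma>) (\<lambda>(t, w). \<psi> t w)" "path \<gamma>"
    and "continuous_on {0..1} (\<lambda>x. vector_derivative \<gamma> (at x))"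
  shows "continuous_on \<Omega> (\<lambda>t. contour_integral \<gamma> (\<psi> t))"
  unfolding contour_integral_integral box_real[symmetric]
proof (rule integral_continuous_on_param)
  have "continuous_on (\<Omega> \<times> cbox 0 1) (\<lambda>x. (\<lambda>(t, w). \<psi> t w) (fst x, \<gamma> (snd x)) * vector_derivative \<gamma> (at (snd x)))"
  proof (rule continuous_on_mult)
    have "continuous_on (\<Omega> \<times> cbox 0 1) (\<lambda>x. \<gamma> (snd x))"
      by (rule continuous_on_compose2[of "{0..1}" \<gamma>]) (use assms in \<open>auto simp: path_def intro!: continuous_intros\<close>)
    then show "continuous_on (\<Omega> \<times> cbox 0 1) (\<lambda>x. (\<lambda>(t, w). \<psi> t w) (fst x, \<gamma> (snd x)))"
      by (intro continuous_on_compose2[OF assms(1)])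
         (auto simp: path_image_def intro!: continuous_intros)
    show "continuous_on (\<Omega> \<times> cbox 0 1) (\<lambda>x. vector_derivative \<gamma> (at (snd x)))"
      by (rule continuous_on_compose2[OF assms(3)]) (auto intro!: continuous_intros)
  qed
  then show "continuous_on (\<Omega> \<times> cbox 0 1) (\<lambda>(t, x). \<psi> t (\<gamma> x) * vector_derivative \<gamma> (at x))"
    by (simp add: case_prod_unfold)
qed

lemma continuous_on_vector_derivative_circlepath:
  "continuous_on A (\<lambda>x. vector_derivative (circlepath a \<rho>) (at x))"
  unfolding vector_derivative_circlepath by (intro continuous_intros)

text \<open>Morera's theorem: after exchanging the two integrations, the integral over a triangle in
  \<open>t\<close> vanishes for each fixed \<open>w\<close> by Cauchy's theorem.\<close>

lemma holomorphic_on_circle_integral_param: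
  fixes \<psi> :: "complex \<Rightarrow> complex \<Rightarrow> complex"
  assumes "open \<Omega>" and cont: "continuous_on (\<Omega> \<times> sphere a \<rho>) (\<lambda>(t, w). \<psi> t w)" and "\<rho> \<ge> 0"
    and hol: "\<And>w. w \<in> sphere a \<rho> \<Longrightarrow> (\<lambda>t. \<psi> t w) holomorphic_on \<Omega>"
  shows "(\<lambda>t. contour_integral (circlepath a \<rho>) (\<psi> t)) holomorphic_on \<Omega>"
proof -
  let ?C = "circlepath a \<rho>"
  have [simp]: "\<bar>\<rho>\<bar> = \<rho>"
    using \<open>\<rho> \<ge> 0\<close> by simp
  have swap: "contour_integral (linepath p q) (\<lambda>t. contour_integral ?C (\<psi> t)) =
      contour_integral ?C (\<lambda>w. contour_integral (linepath p q) (\<lambda>t. \<psi> t w))"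
    and int: "(\<lambda>w. contour_integral (linepath p q) (\<lambda>t. \<psi> t w)) contour_integrable_on ?C"
    if "closed_segment p q \<subseteq> \<Omega>" for p q
  proof -
    have c: "continuous_on (closed_segment p q \<times> sphere a \<rho>) (\<lambda>(t, w). \<psi> t w)"
      by (rule continuous_on_subset[OF cont]) (use that in auto)
    show "contour_integral (linepath p q) (\<lambda>t. contour_integral ?C (\<psi> t)) =
      contour_integral ?C (\<lambda>w. contour_integral (linepath p q) (\<lambda>t. \<psi> t w))"
      by (rule contour_integral_swap) (use c continuous_on_vector_derivative_circlepath in simp_all)
    have "continuous_on (sphere a \<rho> \<times> closed_segment p q) ((\<lambda>(t, w). \<psi> t w) \<circ> prod.swap)"
      by (rule continuous_on_compose[OF continuous_on_swap]) (use c in \<open>simp add: product_swap\<close>)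
    then have "continuous_on (sphere a \<rho>) (\<lambda>w. contour_integral (linepath p q) (\<lambda>t. \<psi> t w))"
      by (intro continuous_on_contour_integral_param) (simp_all add: case_prod_unfold comp_def)
    then show "(\<lambda>w. contour_integral (linepath p q) (\<lambda>t. \<psi> t w)) contour_integrable_on ?C"
      by (intro contour_integrable_continuous_circlepath) simp
  qed
  have "(\<lambda>t. contour_integral ?C (\<psi> t)) analytic_on \<Omega>"
  proof (rule Morera_triangle)
    show "continuous_on \<Omega> (\<lambda>t. contour_integral ?C (\<psi> t))"
      by (rule continuous_on_contour_integral_param)
        (use cont continuous_on_vector_derivative_circlepath in simp_all)
    show "convex hull {p, q, r} \<subseteq> \<Omega> \<longrightarrow>
      contour_integral (linepath p q) (\<lambda>t. contour_integral ?C (\<psi> t)) +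
      contour_integral (linepath q r) (\<lambda>t. contour_integral ?C (\<psi> t)) +
      contour_integral (linepath r p) (\<lambda>t. contour_integral ?C (\<psi> t)) = 0" for p q r
    proof
      assume sub: "convex hull {p, q, r} \<subseteq> \<Omega>"
      have segs: "closed_segment p q \<subseteq> \<Omega>" "closed_segment q r \<subseteq> \<Omega>" "closed_segment r p \<subseteq> \<Omega>"
        using sub by (auto simp: segment_convex_hull elim!: subsetD dest!: subsetD[OF hull_mono[of _ "{p,q,r}"], rotated])
      have "contour_integral (linepath p q) (\<lambda>t. contour_integral ?C (\<psi> t)) +
        contour_integral (linepath q r) (\<lambda>t. contour_integral ?C (\<psi> t)) +
        contour_integral (linepath r p) (\<lambda>t. contour_integral ?C (\<psi> t)) =
        contour_integral ?C (\<lambda>w. contour_integral (linepath p q) (\<lambda>t. \<psi> t w) +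
          contour_integral (linepath q r) (\<lambda>t. \<psi> t w) + contour_integral (linepath r p) (\<lambda>t. \<psi> t w))"
        by (simp add: segs swap int contour_integral_add contour_integrable_add)
      also have "\<dots> = contour_integral ?C (\<lambda>_. 0)"
      proof (rule contour_integral_cong)
        fix w assume "w \<in> path_image ?C"
        then have "(\<lambda>t. \<psi> t w) holomorphic_on convex hull {p, q, r}"
          using hol sub by (auto intro: holomorphic_on_subset)
        then show "contour_integral (linepath p q) (\<lambda>t. \<psi> t w) +
          contour_integral (linepath q r) (\<lambda>t. \<psi> t w) + contour_integral (linepath r p) (\<lambda>t. \<psi> t w) = 0"
          by (intro has_chain_integral_chain_integral3 Cauchy_theorem_triangle)
      qed simp
      finally show "contour_integral (linepath p q) (\<lambda>t. contour_integral ?C (\<psi> t)) +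
        contour_integral (linepath q r) (\<lambda>t. contour_integral ?C (\<psi> t)) +
        contour_integral (linepath r p) (\<lambda>t. contour_integral ?C (\<psi> t)) = 0"
        by simp
    qed
  qed fact
  then show ?thesis
    by (rule analytic_imp_holomorphic)
qed

lemma line_holomorphic_on_circle_integral:
  assumes "open D" and cont: "continuous_on (D \<times> sphere a \<rho>) (\<lambda>(z, w). \<phi> z w)" and "\<rho> \<ge> 0"
    and hol: "\<And>w. w \<in> sphere a \<rho> \<Longrightarrow> line_holomorphic_on (\<lambda>z. \<phi> z w) D"
  shows "line_holomorphic_on (\<lambda>z. contour_integral (circlepath a \<rho>) (\<phi> z)) D"
  unfolding line_holomorphic_on_def
proof (intro conjI allI)
  show "continuous_on D (\<lambda>z. contour_integral (circlepath a \<rho>) (\<phi> z))"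
    by (rule continuous_on_contour_integral_param)
      (use \<open>\<rho> \<ge> 0\<close> cont continuous_on_vector_derivative_circlepath in simp_all)
  fix z u
  show "(\<lambda>t. contour_integral (circlepath a \<rho>) (\<phi> (z + t *s u))) holomorphic_on {t. z + t *s u \<in> D}"
  proof (rule holomorphic_on_circle_integral_param)
    have "continuous_on ({t. z + t *s u \<in> D} \<times> sphere a \<rho>)
        (\<lambda>x. (\<lambda>(z, w). \<phi> z w) (z + fst x *s u, snd x))"
      by (rule continuous_on_compose2[OF cont]) (auto intro!: continuous_intros)
    then show "continuous_on ({t. z + t *s u \<in> D} \<times> sphere a \<rho>) (\<lambda>(t, w). \<phi> (z + t *s u) w)"
      by (simp add: case_prod_unfold)
    show "(\<lambda>t. \<phi> (z + t *s u) w) holomorphic_on {t. z + t *s u \<in> D}" if "w \<in> sphere a \<rho>" for w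
      using line_holomorphic_onD(3)[OF hol[OF that]] .
  qed (use assms open_line_vimage in auto)
qed (fact assms)

text \<open>Cauchy's formula writes the derivative as a circle integral of values of
  \<open>f\<close>. Near \<open>b\<close> the radius of the circle can be kept fixed, so holomorphy
  in the base point passes under the integral.\<close>

lemma line_holomorphic_on_directional_deriv:
  assumes "line_holomorphic_on f U"
  shows "line_holomorphic_on (\<lambda>z. deriv (\<lambda>t. f (z + t *s v)) 0) U"
proof (rule line_holomorphic_on_local)
  note U = line_holomorphic_onD[OF assms]
  show "open U" by (fact U)
  fix b assume b: "b \<in> U"
  have "open {t. b + t *s v \<in> U}" "0 \<in> {t. b + t *s v \<in> U}"
    using b by (auto intro: open_line_vimage U)
  then obtain \<rho> where \<rho>: "\<rho> > 0" "cball 0 \<rho> \<subseteq> {t. b + t *s v \<in> U}"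
    using open_contains_cball by meson
  obtain r where r: "r > 0" "\<And>z w. z \<in> ball b r \<Longrightarrow> w \<in> cball 0 \<rho> \<Longrightarrow> z + w *s v \<in> U"
    by (rule line_tube[of U "cball 0 \<rho>" b v]) (use \<rho> U in auto)
  define g where "g z = 1 / (2 * of_real pi * \<i>) * contour_integral (circlepath 0 \<rho>) (\<lambda>w. f (z + w *s v) / w^2)" for z
  have "line_holomorphic_on g (ball b r)"
    unfolding g_def
  proof (intro line_holomorphic_on_mult line_holomorphic_on_const line_holomorphic_on_circle_integral)
    have "continuous_on (ball b r \<times> sphere 0 \<rho>) (\<lambda>x. f (fst x + snd x *s v))"
      by (rule continuous_on_compose2[OF U(2)]) (use r in \<open>auto intro!: continuous_intros\<close>)
    moreover have "w \<noteq> 0" if "w \<in> sphere 0 \<rho>" for w :: complex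
      using that \<rho> by auto
    ultimately show "continuous_on (ball b r \<times> sphere 0 \<rho>) (\<lambda>(z, w). f (z + w *s v) / w\<^sup>2)"
      unfolding case_prod_unfold by (intro continuous_intros) auto
    fix w :: complex assume "w \<in> sphere 0 \<rho>"
    then show "line_holomorphic_on (\<lambda>z. f (z + w *s v) / w\<^sup>2) (ball b r)"
      by (intro line_holomorphic_on_divide line_holomorphic_on_const line_holomorphic_on_translate[OF assms])
        (use r \<rho> in auto)
  qed (use \<rho> in auto)
  moreover have "g z = deriv (\<lambda>t. f (z + t *s v)) 0" if "z \<in> ball b r" for z
  proof -
    have h: "(\<lambda>t. f (z + t *s v)) holomorphic_on cball 0 \<rho>"
      by (rule holomorphic_on_subset[OF U(3)]) (use r that in auto)
    have "((\<lambda>t. f (z + t *s v)) has_field_derivative (1 / (2 * of_real pi * \<i>) *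
        contour_integral (circlepath 0 \<rho>) (\<lambda>w. f (z + w *s v) / (w - 0)^2))) (at 0)"
      by (rule Cauchy_derivative_integral_circlepath(2))
       (use h \<rho> in \<open>auto intro: holomorphic_on_imp_continuous_on holomorphic_on_subset\<close>)
    then show ?thesis
      by (simp add: g_def DERIV_imp_deriv)
  qed
  ultimately have "line_holomorphic_on (\<lambda>z. deriv (\<lambda>t. f (z + t *s v)) 0) (ball b r)"
    by (rule line_holomorphic_on_cong)
  then show "\<exists>V. b \<in> V \<and> line_holomorphic_on (\<lambda>z. deriv (\<lambda>t. f (z + t *s v)) 0) V"
    using \<open>r > 0\<close> by (intro exI[of _ "ball b r"]) auto
qed

subsection \<open>Identity theorem and Riemann extension\<close>

text \<open>Only the complex line through \<open>p\<close> and \<open>z\<close> matters: convexity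
  makes its intersection with \<open>D\<close> connected, and near \<open>p\<close> it runs inside
  \<open>V\<close>.\<close>

lemma line_holomorphic_identity:
  assumes "line_holomorphic_on f D" "convex D" "open V" "V \<subseteq> D" "p \<in> V"
    and "\<And>z. z \<in> V \<Longrightarrow> f z = 0" "z \<in> D"
  shows "f z = 0"
proof -
  let ?l = "\<lambda>t. p + t *s (z - p)"
  have "f (?l 1) = 0"
  proof (rule analytic_continuation_open[of "{t. ?l t \<in> V}" "{t. ?l t \<in> D}" "\<lambda>t. f (?l t)" "\<lambda>_. 0" 1])
    show "open {t. ?l t \<in> V}" "open {t. ?l t \<in> D}"
      using assms line_holomorphic_onD(1) by (blast intro: open_line_vimage)+
    show "connected {t. ?l t \<in> D}"
      by (intro convex_connected convex_line_vimage assms)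
    show "{t. ?l t \<in> V} \<noteq> {}"
      using assms by (auto intro: exI[of _ 0])
    show "(\<lambda>t. f (?l t)) holomorphic_on {t. ?l t \<in> D}"
      by (rule line_holomorphic_onD) fact
  qed (use assms in auto)
  then show ?thesis by simp
qed

lemma line_holomorphic_nonzero_dense:
  assumes "line_holomorphic_on H D" "convex D" "p \<in> D" "H p \<noteq> 0"
  shows "D \<subseteq> closure {z\<in>D. H z \<noteq> 0}"
proof (rule ccontr)
  assume "\<not> D \<subseteq> closure {z\<in>D. H z \<noteq> 0}"
  then obtain z where z: "z \<in> D \<inter> - closure {z\<in>D. H z \<noteq> 0}"
    by blast
  have "H p = 0"
  proof (rule line_holomorphic_identity[OF assms(1,2) _ _ z _ \<open>p \<in> D\<close>])
    show "open (D \<inter> - closure {z \<in> D. H z \<noteq> 0})"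
      using line_holomorphic_onD(1)[OF assms(1)] by auto
    show "H x = 0" if "x \<in> D \<inter> - closure {z \<in> D. H z \<noteq> 0}" for x
      using that closure_subset[of "{z \<in> D. H z \<noteq> 0}"] by auto
  qed auto
  with assms show False by simp
qed

lemma line_holomorphic_open_nonzero:
  assumes "line_holomorphic_on H D"
  shows "open {z\<in>D. H z \<noteq> 0}"
  using continuous_open_preimage[OF line_holomorphic_onD(2,1)[OF assms], of "-{0}"]
  by (simp add: vimage_def Int_def open_Compl)

text \<open>On the complex line through two points of the set, \<open>H\<close> is not identically
  zero, so its zeros there are countable. Removing countably many points from a connected open
  subset of the plane leaves it connected.\<close>

lemma line_holomorphic_connected_nonzero:
  assumes H: "line_holomorphic_on H D" and "convex D"
  shows "connected {z\<in>D. H z \<noteq> 0}"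
  unfolding connected_iff_connected_component
proof (intro ballI)
  fix x y assume x: "x \<in> {z\<in>D. H z \<noteq> 0}" and y: "y \<in> {z\<in>D. H z \<noteq> 0}"
  let ?l = "\<lambda>t. x + t *s (y - x)"
  let ?S = "{t. ?l t \<in> D}"
  have S: "open ?S" "connected ?S"
    by (intro open_line_vimage convex_connected convex_line_vimage line_holomorphic_onD(1)[OF H] \<open>convex D\<close>)+
  have hol: "(\<lambda>t. H (?l t)) holomorphic_on ?S"
    by (rule line_holomorphic_onD[OF H])
  have "countable {t\<in>?S. H (?l t) = 0}"
  proof (cases "(\<lambda>t. H (?l t)) constant_on ?S")
    case True
    have "0 \<in> ?S" "H (?l 0) \<noteq> 0"
      using x by auto
    with True have "H (?l t) \<noteq> 0" if "t \<in> ?S" for t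
      using that unfolding constant_on_def by metis
    then have "{t\<in>?S. H (?l t) = 0} = {}"
      by blast
    then show ?thesis by (metis countable_empty)
  next
    case False
    have "fsigma ?S"
      using open_Union_compact_subsets[OF S(1)] unfolding fsigma_Union_compact
      by (metis image_subset_iff mem_Collect_eq)
    with hol S False show ?thesis
      by (intro holomorphic_countable_zeros)
  qed
  then have "connected (?S - {t\<in>?S. H (?l t) = 0})"
    by (intro connected_open_diff_countable S) simp
  then have "connected (?l ` (?S - {t\<in>?S. H (?l t) = 0}))"
    by (intro connected_continuous_image continuous_intros)
  moreover have "x \<in> ?l ` (?S - {t\<in>?S. H (?l t) = 0})" "y \<in> ?l ` (?S - {t\<in>?S. H (?l t) = 0})"
    using x y by (auto intro: rev_image_eqI[of 0] rev_image_eqI[of 1])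
  moreover have "?l ` (?S - {t\<in>?S. H (?l t) = 0}) \<subseteq> {z\<in>D. H z \<noteq> 0}"
    by auto
  ultimately show "connected_component {z\<in>D. H z \<noteq> 0} x y"
    unfolding connected_component_def by blast
qed

lemma enlarge_cball:
  fixes a :: complex
  assumes "open \<Omega>" "cball a \<rho> \<subseteq> \<Omega>" "\<rho> > 0"
  obtains \<rho>' where "\<rho>' > \<rho>" "cball a \<rho>' \<subseteq> \<Omega>"
proof -
  obtain e where e: "e > 0" "(\<Union>x\<in>cball a \<rho>. ball x e) \<subseteq> \<Omega>"
    using compact_subset_open_imp_ball_epsilon_subset[OF compact_cball assms(1,2)] by blast
  have "cball a (\<rho> + e/2) \<subseteq> \<Omega>"
  proof
    fix w assume w: "w \<in> cball a (\<rho> + e/2)"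
    show "w \<in> \<Omega>"
    proof (cases "w \<in> cball a \<rho>")
      case False
      define d where "d = norm (w - a)"
      have d: "d > \<rho>" "d \<le> \<rho> + e/2"
        using False w by (auto simp: d_def dist_norm norm_minus_commute)
      \<comment> \<open>Radial projection of \<open>w\<close> to the circle; its distance from
        \<open>w\<close> is \<open>d - \<rho>\<close>, at most \<open>e/2\<close>.\<close>
      define x where "x = a + of_real (\<rho> / d) * (w - a)"
      have x: "norm (x - a) = \<rho>"
        using d \<open>\<rho> > 0\<close> by (simp add: x_def norm_mult norm_divide flip: d_def)
      have "w - x = of_real (1 - \<rho> / d) * (w - a)"
        by (simp add: x_def algebra_simps)
      then have "norm (w - x) = \<bar>1 - \<rho> / d\<bar> * d"
        by (simp only: norm_mult norm_of_real d_def[symmetric])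
      also have "\<dots> = (1 - \<rho> / d) * d"
        using d \<open>\<rho> > 0\<close> by simp
      also have "\<dots> = d - \<rho>"
        using d \<open>\<rho> > 0\<close> by (simp add: left_diff_distrib)
      finally have "norm (w - x) = d - \<rho>" .
      with x have "x \<in> cball a \<rho>" "w \<in> ball x e"
        using d e by (auto simp: dist_norm norm_minus_commute)
      with e show ?thesis by blast
    qed (use assms in auto)
  qed
  with that[of "\<rho> + e/2"] e show ?thesis by simp
qed

text \<open>Being nonzero on the circle, \<open>h\<close> is not identically zero, so its zeros do
  not accumulate inside the domain. The enlarged radius leaves room around the circle for the
  argument principle.\<close>

lemma finite_zeros_cball:
  fixes a :: complex
  assumes "open \<Omega>" "h holomorphic_on \<Omega>" "\<rho> > 0" "cball a \<rho> \<subseteq> \<Omega>" "\<And>w. w \<in> sphere a \<rho> \<Longrightarrow> h w \<noteq> 0"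
  obtains \<rho>' where "\<rho>' > \<rho>" "cball a \<rho>' \<subseteq> \<Omega>" "finite {w\<in>cball a \<rho>'. h w = 0}"
proof -
  obtain \<rho>'' where \<rho>'': "\<rho>'' > \<rho>" "cball a \<rho>'' \<subseteq> \<Omega>"
    using enlarge_cball assms by blast
  \<comment> \<open>The middle radius makes the closed disc a compact subset of an open disc on
    which \<open>h\<close> is holomorphic.\<close>
  define \<rho>' where "\<rho>' = (\<rho> + \<rho>'') / 2"
  have \<rho>': "\<rho>' > \<rho>" "\<rho>' < \<rho>''"
    using \<rho>'' by (auto simp: \<rho>'_def)
  have sub: "cball a \<rho>' \<subseteq> ball a \<rho>''"
    using \<rho>' by auto
  have hol: "h holomorphic_on ball a \<rho>''"
    using assms(2) \<rho>'' ball_subset_cball by (meson holomorphic_on_subset order_trans)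
  have p: "a + of_real \<rho> \<in> sphere a \<rho>"
    using \<open>\<rho> > 0\<close> by (simp add: dist_norm)
  then have p': "a + of_real \<rho> \<in> ball a \<rho>''" "h (a + of_real \<rho>) \<noteq> 0"
    using \<rho>'' assms(5) by auto
  have "finite {w\<in>cball a \<rho>'. h w = 0}"
  proof (cases "h constant_on ball a \<rho>''")
    case True
    then have "h w \<noteq> 0" if "w \<in> ball a \<rho>''" for w
      using p' that unfolding constant_on_def by metis
    then have "{w\<in>cball a \<rho>'. h w = 0} = {}"
      using sub by blast
    then show ?thesis by (metis finite.emptyI)
  qed (use hol sub in \<open>intro holomorphic_compact_finite_zeros[of _ "ball a \<rho>''"]; simp\<close>)
  moreover have "cball a \<rho>' \<subseteq> \<Omega>"
    using sub \<rho>''(2) ball_subset_cball by blast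
  ultimately show ?thesis
    using that \<rho>' by blast
qed

text \<open>The extension is a Cauchy integral over a small circle in a direction along which
  \<open>H\<close> is not identically zero at \<open>b\<close>. The circle avoids the zeros of
  \<open>H\<close> for all base points near \<open>b\<close>, and one-variable removable
  singularities on each slice identify the integral with \<open>g\<close>.\<close>

theorem line_holomorphic_Riemann_extension:
  assumes H: "line_holomorphic_on H (ball b R)" and "p \<in> ball b R" "H p \<noteq> 0"
    and g: "line_holomorphic_on g {z\<in>ball b R. H z \<noteq> 0}"
    and bdd: "\<And>z. z \<in> ball b R \<Longrightarrow> H z \<noteq> 0 \<Longrightarrow> norm (g z) \<le> M"
  obtains r G where "0 < r" "r \<le> R" "line_holomorphic_on G (ball b r)"
    "\<And>z. z \<in> ball b r \<Longrightarrow> H z \<noteq> 0 \<Longrightarrow> G z = g z"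
proof (cases "H b = 0")
  case False
  have "R > 0"
    using \<open>p \<in> ball b R\<close> by (metis ball_eq_empty empty_iff not_le)
  then have b: "b \<in> {z\<in>ball b R. H z \<noteq> 0}"
    using False by simp
  then obtain r where r: "r > 0" "ball b r \<subseteq> {z\<in>ball b R. H z \<noteq> 0}"
    using line_holomorphic_open_nonzero[OF H] open_contains_ball by meson
  show ?thesis
  proof
    show "line_holomorphic_on g (ball b (min r R))"
      by (rule line_holomorphic_on_subset[OF g]) (use r in auto)
  qed (use r \<open>R > 0\<close> in auto)
next
  case True
  \<comment> \<open>On the line from \<open>b\<close> towards \<open>p\<close> the function
    \<open>H\<close> is not identically zero, so its zero at \<open>b\<close> is isolated
    there.\<close>
  define u where "u = p - b"
  let ?l = "\<lambda>z t. z + t *s u"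
  let ?S = "{t. ?l b t \<in> ball b R}"
  have b: "b \<in> ball b R"
    using \<open>p \<in> ball b R\<close> by (metis ball_eq_empty centre_in_ball empty_iff not_le)
  have hol: "(\<lambda>t. H (?l b t)) holomorphic_on ?S"
    by (rule line_holomorphic_onD[OF H])
  have S: "open ?S" "connected ?S"
    by (intro open_line_vimage convex_connected convex_line_vimage convex_ball open_ball)+
  obtain \<rho>' where \<rho>': "\<rho>' > 0" "ball 0 \<rho>' \<subseteq> ?S" "\<And>t. t \<in> ball 0 \<rho>' - {0} \<Longrightarrow> H (?l b t) \<noteq> 0"
    using isolated_zeros[OF hol S, of 0 1] True b assms(2,3) by (auto simp: u_def)
  define \<rho> where "\<rho> = \<rho>' / 2"
  have \<rho>: "\<rho> > 0" "\<rho> < \<rho>'"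
    using \<rho>' by (auto simp: \<rho>_def)
  obtain r1 where r1: "r1 > 0" "\<And>z t. z \<in> ball b r1 \<Longrightarrow> t \<in> cball 0 \<rho> \<Longrightarrow> ?l z t \<in> ball b R"
  proof (rule line_tube[of "ball b R" "cball 0 \<rho>" b u])
    show "?l b w \<in> ball b R" if "w \<in> cball 0 \<rho>" for w
    proof -
      have "w \<in> ball 0 \<rho>'"
        using that \<rho> by auto
      then show ?thesis using \<rho>' by blast
    qed
  qed auto
  obtain r2 where r2: "r2 > 0" "\<And>z t. z \<in> ball b r2 \<Longrightarrow> t \<in> sphere 0 \<rho> \<Longrightarrow> ?l z t \<in> {z\<in>ball b R. H z \<noteq> 0}"
  proof (rule line_tube[OF line_holomorphic_open_nonzero[OF H], of "sphere 0 \<rho>" b u])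
    show "?l b w \<in> {z\<in>ball b R. H z \<noteq> 0}" if "w \<in> sphere 0 \<rho>" for w
    proof -
      have "w \<in> ball 0 \<rho>' - {0}"
        using that \<rho> by auto
      then show ?thesis using \<rho>' by auto
    qed
  qed auto
  define r where "r = Min {r1, r2, R}"
  have "R > 0"
    using b by simp
  have r: "r > 0" "r \<le> r1" "r \<le> r2" "r \<le> R"
    using r1 r2 \<open>R > 0\<close> by (auto simp: r_def)
  \<comment> \<open>Only values of \<open>g\<close> on the circle enter, and \<open>H\<close> has no
    zeros there; hence the integral makes sense also where \<open>H z = 0\<close>.\<close>
  define G where "G z = 1 / (2 * of_real pi * \<i>) * contour_integral (circlepath 0 \<rho>) (\<lambda>t. g (?l z t) / t)" for z
  show ?thesis
  proof
    show "line_holomorphic_on G (ball b r)"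
      unfolding G_def
    proof (intro line_holomorphic_on_mult line_holomorphic_on_const line_holomorphic_on_circle_integral)
      have "continuous_on (ball b r \<times> sphere 0 \<rho>) (\<lambda>x. g (?l (fst x) (snd x)))"
        by (rule continuous_on_compose2[OF line_holomorphic_onD(2)[OF g]])
          (use r r2 in \<open>auto intro!: continuous_intros\<close>)
      moreover have "w \<noteq> 0" if "w \<in> sphere 0 \<rho>" for w :: complex
        using that \<rho> by auto
      ultimately show "continuous_on (ball b r \<times> sphere 0 \<rho>) (\<lambda>(z, w). g (?l z w) / w)"
        unfolding case_prod_unfold by (intro continuous_intros) auto
      fix w :: complex assume "w \<in> sphere 0 \<rho>"
      then show "line_holomorphic_on (\<lambda>z. g (?l z w) / w) (ball b r)"
        by (intro line_holomorphic_on_divide line_holomorphic_on_const line_holomorphic_on_translate[OF g])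
          (use r r2 \<rho> in auto)
    qed (use \<rho> in auto)
  next
    fix z assume z: "z \<in> ball b r" "H z \<noteq> 0"
    define W where "W = {t. ?l z t \<in> {z\<in>ball b R. H z \<noteq> 0}}"
    have "open W"
      unfolding W_def by (intro open_line_vimage line_holomorphic_open_nonzero H)
    define K where "K = {t\<in>ball 0 \<rho>. H (?l z t) = 0}"
    have inD: "?l z t \<in> ball b R" if "t \<in> cball 0 \<rho>" for t
      using r1 z r that by auto
    have sph: "sphere 0 \<rho> \<subseteq> W"
      using r2 z r by (auto simp: W_def)
    have "finite {t\<in>cball 0 \<rho>. H (?l z t) = 0}"
    proof (rule finite_zeros_cball[of "{t. ?l z t \<in> ball b R}" "\<lambda>t. H (?l z t)" \<rho> 0])
      fix \<rho>' assume "\<rho>' > \<rho>" "finite {w \<in> cball 0 \<rho>'. H (?l z w) = 0}"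
      then show ?thesis
        by (elim rev_finite_subset) auto
    next
      show "open {t. ?l z t \<in> ball b R}"
        by (intro open_line_vimage open_ball)
      show "(\<lambda>t. H (?l z t)) holomorphic_on {t. ?l z t \<in> ball b R}"
        by (rule line_holomorphic_onD[OF H])
      show "H (?l z w) \<noteq> 0" if "w \<in> sphere 0 \<rho>" for w
        using that sph by (auto simp: W_def)
    qed (use \<rho> inD in auto)
    then have "finite K"
      by (rule rev_finite_subset) (auto simp: K_def)
    \<comment> \<open>The slice of \<open>g\<close> lives on \<open>W\<close>; filling in the disc
      adds only the finitely many points of \<open>K\<close>, which are removable because
      \<open>g\<close> is bounded.\<close>
    define S where "S = ball 0 \<rho> \<union> W"
    have "open S"
      using \<open>open W\<close> by (auto simp: S_def)
    have SK: "S - K = W"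
      using inD by (auto simp: S_def K_def W_def)
    have "\<exists>h. h holomorphic_on S \<and> (\<forall>t\<in>S-K. h t = g (?l z t))"
    proof (rule removable_singularities[OF \<open>finite K\<close>])
      show "K \<subseteq> interior S"
        using \<open>open S\<close> by (auto simp: interior_open K_def S_def)
      show "(\<lambda>t. g (?l z t)) holomorphic_on S - K"
        unfolding SK W_def by (rule line_holomorphic_onD[OF g])
      fix t0 assume "t0 \<in> K"
      have "\<forall>\<^sub>F t in at t0. t \<in> S - (K - {t0}) - {t0}"
      proof (rule eventually_at_in_open)
        show "open (S - (K - {t0}))"
          using \<open>open S\<close> \<open>finite K\<close> by (intro open_Diff finite_imp_closed) auto
        show "t0 \<in> S - (K - {t0})"
          using \<open>t0 \<in> K\<close> by (auto simp: S_def K_def)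
      qed
      then have "\<forall>\<^sub>F t in at t0. norm (g (?l z t)) \<le> M * norm (1 :: complex)"
      proof eventually_elim
        case (elim t)
        then have "t \<in> W" using SK by blast
        then show ?case using bdd by (auto simp: W_def)
      qed
      then show "(\<lambda>t. g (?l z t)) \<in> O[at t0](\<lambda>_. 1)"
        by (rule bigoI)
    qed
    then obtain h where h: "h holomorphic_on S" "\<And>t. t \<in> W \<Longrightarrow> h t = g (?l z t)"
      unfolding SK by blast
    have "cball 0 \<rho> \<subseteq> S"
      using sph by (auto simp: S_def less_eq_real_def)
    then have h': "h holomorphic_on cball 0 \<rho>"
      using h(1) holomorphic_on_subset by blast
    have "((\<lambda>t. h t / (t - 0)) has_contour_integral (2 * of_real pi * \<i> * h 0)) (circlepath 0 \<rho>)"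
      by (rule Cauchy_integral_circlepath)
        (use h' \<rho> in \<open>auto intro: holomorphic_on_imp_continuous_on holomorphic_on_subset[OF _ ball_subset_cball]\<close>)
    then have "contour_integral (circlepath 0 \<rho>) (\<lambda>t. h t / t) = 2 * of_real pi * \<i> * h 0"
      by (simp add: contour_integral_unique)
    moreover have "contour_integral (circlepath 0 \<rho>) (\<lambda>t. h t / t) = contour_integral (circlepath 0 \<rho>) (\<lambda>t. g (?l z t) / t)"
      by (rule contour_integral_cong) (use h sph \<rho> in auto)
    moreover have "h 0 = g z"
      using h(2)[of 0] z r by (auto simp: W_def)
    ultimately show "G z = g z"
      by (simp add: G_def)
  qed (use r in auto)
qed

subsection \<open>Zeros in a disc\<close>

text \<open>The weight \<open>x ^ i\<close> turns the count of zeros into the sum of their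
  \<open>i\<close>-th powers with multiplicity, written as an integral that can be varied with a
  parameter.\<close>

lemma argument_principle_disc:
  fixes a :: complex
  assumes "open \<Omega>" "h holomorphic_on \<Omega>" "\<rho> > 0" "cball a \<rho> \<subseteq> \<Omega>" "\<And>w. w \<in> sphere a \<rho> \<Longrightarrow> h w \<noteq> 0"
  shows "finite {w\<in>ball a \<rho>. h w = 0}"
    and "\<And>w. w \<in> ball a \<rho> \<Longrightarrow> h w = 0 \<Longrightarrow> zorder h w > 0"
    and "contour_integral (circlepath a \<rho>) (\<lambda>x. deriv h x * x ^ i / h x) =
      2 * of_real pi * \<i> * (\<Sum>w | w \<in> ball a \<rho> \<and> h w = 0. w ^ i * of_int (zorder h w))"
proof -
  obtain \<rho>' where \<rho>': "\<rho>' > \<rho>" "cball a \<rho>' \<subseteq> \<Omega>" and fin: "finite {w\<in>cball a \<rho>'. h w = 0}"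
    using finite_zeros_cball assms by blast
  let ?Z = "{w\<in>ball a \<rho>. h w = 0}" and ?Z' = "{w\<in>ball a \<rho>'. h w = 0}"
  have fin': "finite ?Z'"
    by (rule finite_subset[OF _ fin]) auto
  have sub: "?Z \<subseteq> ?Z'"
    using \<rho>' by auto
  then show "finite ?Z"
    using fin' finite_subset by blast
  have hol: "h holomorphic_on ball a \<rho>'"
    using assms(2) \<rho>' ball_subset_cball by (blast intro: holomorphic_on_subset)
  have "a + of_real \<rho> \<in> sphere a \<rho>"
    using \<open>\<rho> > 0\<close> by (simp add: dist_norm)
  then have nz: "\<exists>w\<in>ball a \<rho>'. h w \<noteq> 0"
    using assms(5) \<rho>' by (intro bexI[of _ "a + of_real \<rho>"]) auto
  show "zorder h w > 0" if "w \<in> ball a \<rho>" "h w = 0" for w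
    using zorder_exist_zero[OF hol _ _ _ nz, of w] that \<rho>' by auto
  have "contour_integral (circlepath a \<rho>) (\<lambda>x. deriv h x * x ^ i / h x) =
    2 * pi * \<i> * (\<Sum>p\<in>{w \<in> ball a \<rho>'. h w = 0 \<or> w \<in> {}}. winding_number (circlepath a \<rho>) p * p ^ i * of_int (zorder h p))"
  proof (rule argument_principle)
    show "path_image (circlepath a \<rho>) \<subseteq> ball a \<rho>' - {w \<in> ball a \<rho>'. h w = 0 \<or> w \<in> {}}"
      using assms(3,5) \<rho>' by auto
    show "\<forall>z. z \<notin> ball a \<rho>' \<longrightarrow> winding_number (circlepath a \<rho>) z = 0"
    proof (intro allI impI winding_number_zero_outside[where s = "cball a \<rho>"])
      show "z \<notin> cball a \<rho>" if "z \<notin> ball a \<rho>'" for z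
        using that \<rho>' by auto
    qed (use assms in auto)
  qed (use hol fin' in \<open>auto intro!: holomorphic_intros\<close>)
  also have "{w \<in> ball a \<rho>'. h w = 0 \<or> w \<in> {}} = ?Z'"
    by simp
  also have "(\<Sum>p\<in>?Z'. winding_number (circlepath a \<rho>) p * p ^ i * of_int (zorder h p)) =
    (\<Sum>p\<in>?Z. p ^ i * of_int (zorder h p))"
  proof (rule sum.mono_neutral_cong_right[OF fin' sub])
    show "\<forall>p\<in>?Z' - ?Z. winding_number (circlepath a \<rho>) p * p ^ i * of_int (zorder h p) = 0"
    proof
      fix p assume p: "p \<in> ?Z' - ?Z"
      then have "p \<notin> cball a \<rho>"
        using assms(5)[of p] by (auto simp: less_eq_real_def)
      then have "winding_number (circlepath a \<rho>) p = 0"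
        by (intro winding_number_zero_outside[where s = "cball a \<rho>"]) (use assms in auto)
      then show "winding_number (circlepath a \<rho>) p * p ^ i * of_int (zorder h p) = 0"
        by simp
    qed
    show "winding_number (circlepath a \<rho>) p * p ^ i * of_int (zorder h p) = p ^ i * of_int (zorder h p)"
      if "p \<in> ?Z" for p
      using that by (simp add: winding_number_circlepath dist_norm norm_minus_commute)
  qed
  finally show "contour_integral (circlepath a \<rho>) (\<lambda>x. deriv h x * x ^ i / h x) =
      2 * of_real pi * \<i> * (\<Sum>w | w \<in> ball a \<rho> \<and> h w = 0. w ^ i * of_int (zorder h w))"
    by simp
qed

text \<open>The setting of the Weierstrass preparation theorem: no zero can cross the circle as the
  base point moves in \<open>D\<close>. The zeros are studied through their power sums instead of a
  Weierstrass polynomial.\<close>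

locale zeros_in_disc =
  fixes f :: "complex ^ 'n \<Rightarrow> complex" and U D :: "(complex ^ 'n) set" and v :: "complex ^ 'n"
    and a :: complex and \<rho> :: real
  assumes line_holomorphic: "line_holomorphic_on f U" and radius_pos: "\<rho> > 0" and open_D: "open D"
    and disc_in_U: "\<And>z w. z \<in> D \<Longrightarrow> w \<in> cball a \<rho> \<Longrightarrow> z + w *s v \<in> U"
    and nonzero_on_circle: "\<And>z w. z \<in> D \<Longrightarrow> w \<in> sphere a \<rho> \<Longrightarrow> f (z + w *s v) \<noteq> 0"
begin

definition zeros :: "complex ^ 'n \<Rightarrow> complex set" where
  "zeros z = {w\<in>ball a \<rho>. f (z + w *s v) = 0}"

definition zero_mult :: "complex ^ 'n \<Rightarrow> complex \<Rightarrow> nat" where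
  "zero_mult z w = nat (zorder (\<lambda>w. f (z + w *s v)) w)"

definition power_sum :: "nat \<Rightarrow> complex ^ 'n \<Rightarrow> complex" where
  "power_sum i z = (\<Sum>w\<in>zeros z. of_nat (zero_mult z w) * w ^ i)"

lemma
  assumes "z \<in> D"
  shows finite_zeros: "finite (zeros z)"
    and zero_mult_pos: "w \<in> zeros z \<Longrightarrow> zero_mult z w > 0"
    and power_sum_eq_integral: "power_sum i z = 1 / (2 * of_real pi * \<i>) * contour_integral (circlepath a \<rho>)
      (\<lambda>w. deriv (\<lambda>t. f (z + w *s v + t *s v)) 0 * w ^ i / f (z + w *s v))"
proof -
  let ?h = "\<lambda>w. f (z + w *s v)" and ?\<Omega> = "{w. z + w *s v \<in> U}"
  have \<Omega>: "open ?\<Omega>" "?h holomorphic_on ?\<Omega>" "cball a \<rho> \<subseteq> ?\<Omega>" "\<And>w. w \<in> sphere a \<rho> \<Longrightarrow> ?h w \<noteq> 0"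
    using line_holomorphic_onD[OF line_holomorphic] disc_in_U[OF assms] nonzero_on_circle[OF assms]
    by (auto intro: open_line_vimage)
  note arg = argument_principle_disc[OF \<Omega>(1,2) radius_pos \<Omega>(3,4)]
  show "finite (zeros z)"
    unfolding zeros_def by (rule arg(1))
  show pos: "zero_mult z w > 0" if "w \<in> zeros z" for w
    using arg(2)[of w] that by (auto simp: zeros_def zero_mult_def)
  \<comment> \<open>Written as a directional derivative of \<open>f\<close> at the shifted point,
    the derivative of the slice becomes a function known to be line-holomorphic in that
    point.\<close>
  have shift: "deriv (\<lambda>t. f (z + w *s v + t *s v)) 0 = deriv ?h w" for w
  proof -
    have "deriv ?h w = deriv (?h \<circ> (\<lambda>t. w + t)) 0"
      by (rule deriv_shift_0)
    then show ?thesis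
      by (simp add: comp_def vector_sadd_rdistrib add.assoc)
  qed
  have "power_sum i z = (\<Sum>w\<in>zeros z. w ^ i * of_int (zorder ?h w))"
    unfolding power_sum_def
  proof (rule sum.cong)
    show "of_nat (zero_mult z w) * w ^ i = w ^ i * of_int (zorder ?h w)" if "w \<in> zeros z" for w
      using pos[OF that] by (simp add: zero_mult_def)
  qed simp
  then show "power_sum i z = 1 / (2 * of_real pi * \<i>) * contour_integral (circlepath a \<rho>)
      (\<lambda>w. deriv (\<lambda>t. f (z + w *s v + t *s v)) 0 * w ^ i / f (z + w *s v))"
    using arg(3)[of i] by (simp add: shift zeros_def)
qed

lemma line_holomorphic_power_sum: "line_holomorphic_on (power_sum i) D"
proof (rule line_holomorphic_on_cong)
  let ?f' = "\<lambda>x. deriv (\<lambda>t. f (x + t *s v)) 0"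
  have f': "line_holomorphic_on ?f' U"
    by (rule line_holomorphic_on_directional_deriv[OF line_holomorphic])
  show "1 / (2 * of_real pi * \<i>) * contour_integral (circlepath a \<rho>) (\<lambda>w. ?f' (z + w *s v) * w ^ i / f (z + w *s v))
      = power_sum i z" if "z \<in> D" for z
    using power_sum_eq_integral[OF that] by simp
  show "line_holomorphic_on (\<lambda>z. 1 / (2 * of_real pi * \<i>) *
      contour_integral (circlepath a \<rho>) (\<lambda>w. ?f' (z + w *s v) * w ^ i / f (z + w *s v))) D"
  proof (intro line_holomorphic_on_mult line_holomorphic_on_const line_holomorphic_on_circle_integral open_D)
    have "continuous_on (D \<times> sphere a \<rho>) (\<lambda>x. f (fst x + snd x *s v))"
      "continuous_on (D \<times> sphere a \<rho>) (\<lambda>x. ?f' (fst x + snd x *s v))"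
      by (rule continuous_on_compose2[OF line_holomorphic_onD(2)[OF line_holomorphic]]
            continuous_on_compose2[OF line_holomorphic_onD(2)[OF f']];
          use disc_in_U in \<open>auto intro!: continuous_intros\<close>)+
    then show "continuous_on (D \<times> sphere a \<rho>) (\<lambda>(z, w). ?f' (z + w *s v) * w ^ i / f (z + w *s v))"
      unfolding case_prod_unfold by (intro continuous_intros) (use nonzero_on_circle in auto)
    fix w assume w: "w \<in> sphere a \<rho>"
    show "line_holomorphic_on (\<lambda>z. ?f' (z + w *s v) * w ^ i / f (z + w *s v)) D"
      by (intro line_holomorphic_on_divide line_holomorphic_on_mult line_holomorphic_on_const open_D
          line_holomorphic_on_translate[OF line_holomorphic] line_holomorphic_on_translate[OF f'])
        (use w disc_in_U nonzero_on_circle in auto)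
  qed (use radius_pos in auto)
qed

lemma power_sum_0: "power_sum 0 z = of_nat (\<Sum>w\<in>zeros z. zero_mult z w)"
  by (simp add: power_sum_def)

text \<open>\<open>power_sum 0\<close> is continuous and takes integer values, so it cannot change
  on a connected set.\<close>

lemma sum_zero_mult_constant:
  assumes "connected D" "x \<in> D" "y \<in> D"
  shows "(\<Sum>w\<in>zeros x. zero_mult x w) = (\<Sum>w\<in>zeros y. zero_mult y w)"
proof -
  have "power_sum 0 constant_on D"
  proof (rule continuous_discrete_range_constant[OF assms(1)])
    show "continuous_on D (power_sum 0)"
      by (rule line_holomorphic_onD[OF line_holomorphic_power_sum])
    fix x
    have "1 \<le> norm (power_sum 0 y - power_sum 0 x)" if "power_sum 0 y \<noteq> power_sum 0 x" for y
    proof -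
      define k where "k = int (\<Sum>w\<in>zeros y. zero_mult y w) - int (\<Sum>w\<in>zeros x. zero_mult x w)"
      have k: "power_sum 0 y - power_sum 0 x = of_int k"
        unfolding power_sum_0 k_def by simp
      with that have "k \<noteq> 0"
        by auto
      then have "1 \<le> \<bar>real_of_int k\<bar>"
        by linarith
      with k show ?thesis
        by simp
    qed
    then show "\<exists>e>0. \<forall>y. y \<in> D \<and> power_sum 0 y \<noteq> power_sum 0 x \<longrightarrow> e \<le> norm (power_sum 0 y - power_sum 0 x)"
      by (intro exI[of _ 1]) auto
  qed
  then have "power_sum 0 x = power_sum 0 y"
    using assms unfolding constant_on_def by metis
  then show ?thesis
    unfolding power_sum_0 of_nat_eq_iff .
qed

lemma card_zeros_le: "z \<in> D \<Longrightarrow> card (zeros z) \<le> (\<Sum>w\<in>zeros z. zero_mult z w)"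
  using sum_mono[of "zeros z" "\<lambda>_. 1" "zero_mult z"] zero_mult_pos by (force simp: Suc_le_eq)

text \<open>The persistence of zeros, as in Hurwitz's theorem; it later yields points of
  \<open>X\<close> on all lines near a regular point and a root in each small disc.\<close>

lemma zeros_nonempty:
  assumes "connected D" "x \<in> D" "y \<in> D" "zeros x \<noteq> {}"
  shows "zeros y \<noteq> {}"
proof
  assume "zeros y = {}"
  then have "(\<Sum>w\<in>zeros x. zero_mult x w) = 0"
    using sum_zero_mult_constant[OF assms(1-3)] by simp
  then have "card (zeros x) = 0"
    using card_zeros_le[OF assms(2)] by simp
  then show False
    using finite_zeros[OF assms(2)] assms(4) by simp
qed

end

section \<open>The discriminant of the distinct zeros\<close>

context zeros_in_disc
begin

text \<open>Summing over all tuples makes the value independent of any numbering of the zeros, which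
  is what lets it be expressed through power sums.\<close>

definition tuple_sum :: "nat \<Rightarrow> ((nat \<Rightarrow> complex) \<Rightarrow> complex) \<Rightarrow> complex ^ 'n \<Rightarrow> complex" where
  "tuple_sum m Q z = (\<Sum>x\<in>PiE {..<m} (\<lambda>_. zeros z). (\<Prod>i<m. of_nat (zero_mult z (x i))) * Q x)"

text \<open>Polynomials in the entries of the tuples are handled by expanding into monomials, for which the
  tuple sum factors into power sums.\<close>

lemma line_holomorphic_tuple_sum_monomial:
  "line_holomorphic_on (tuple_sum m (\<lambda>x. \<Prod>i<m. x i ^ e i)) D"
proof (rule line_holomorphic_on_cong)
  show "line_holomorphic_on (\<lambda>z. \<Prod>i<m. power_sum (e i) z) D"
    by (intro line_holomorphic_on_prod open_D line_holomorphic_power_sum)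
  show "(\<Prod>i<m. power_sum (e i) z) = tuple_sum m (\<lambda>x. \<Prod>i<m. x i ^ e i) z" if "z \<in> D" for z
    unfolding power_sum_def tuple_sum_def
    by (subst prod_sum_PiE) (use finite_zeros[OF that] in \<open>auto simp: prod.distrib\<close>)
qed

text \<open>Multiplying out one factor \<open>x j - x k\<close> leaves two tuple sums of the same
  shape with one exponent raised by one; the exponents \<open>e\<close> are carried along for this
  induction.\<close>

lemma line_holomorphic_tuple_sum:
  assumes "finite S" "S \<subseteq> {..<m} \<times> {..<m}"
  shows "line_holomorphic_on (tuple_sum m (\<lambda>x. (\<Prod>p\<in>S. x (fst p) - x (snd p)) * (\<Prod>i<m. x i ^ e i))) D"
  using assms
proof (induction S arbitrary: e rule: finite_induct)
  case empty
  then show ?case by (simp add: line_holomorphic_tuple_sum_monomial)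
next
  case (insert p S)
  obtain j k where p: "p = (j, k)" "j < m" "k < m"
    using insert.prems by auto
  let ?R = "\<lambda>e x. (\<Prod>p\<in>S. x (fst p) - x (snd p)) * (\<Prod>i<m. x i ^ e i :: complex)"
  have shift: "(\<Prod>i<m. x i ^ (e(l := Suc (e l))) i) = x l * (\<Prod>i<m. x i ^ e i)" if "l < m" for l and x :: "nat \<Rightarrow> complex"
  proof -
    have "(\<Prod>i<m. x i ^ (e(l := Suc (e l))) i) = (\<Prod>i<m. (if i = l then x l else 1) * x i ^ e i)"
      by (intro prod.cong) auto
    then show ?thesis
      using that by (simp add: prod.distrib)
  qed
  have "tuple_sum m (\<lambda>x. (\<Prod>p\<in>insert p S. x (fst p) - x (snd p)) * (\<Prod>i<m. x i ^ e i)) z =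
      tuple_sum m (?R (e(j := Suc (e j)))) z - tuple_sum m (?R (e(k := Suc (e k)))) z" for z
    unfolding tuple_sum_def sum_subtractf[symmetric] shift[OF p(2)] shift[OF p(3)]
    using insert.hyps by (intro sum.cong) (simp_all add: p algebra_simps)
  moreover have "line_holomorphic_on (\<lambda>z. tuple_sum m (?R (e(j := Suc (e j)))) z - tuple_sum m (?R (e(k := Suc (e k)))) z) D"
    using insert.prems by (intro line_holomorphic_on_diff insert.IH) auto
  ultimately show ?case
    by (metis (no_types, lifting) line_holomorphic_on_cong)
qed

definition off_diagonal :: "nat \<Rightarrow> (nat \<times> nat) set" where
  "off_diagonal m = {(i, j). i < m \<and> j < m \<and> i \<noteq> j}"

text \<open>Tuples with a repeated entry contribute \<open>0\<close>, so only \<open>m\<close>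
  distinct zeros can be detected. The classical discriminant would vanish identically if
  \<open>f\<close> had a repeated factor; here \<open>m\<close> will be the generic number of
  distinct zeros.\<close>

definition discriminant :: "nat \<Rightarrow> complex ^ 'n \<Rightarrow> complex" where
  "discriminant m = tuple_sum m (\<lambda>x. \<Prod>p\<in>off_diagonal m. x (fst p) - x (snd p))"

lemma off_diagonal_subset: "off_diagonal m \<subseteq> {..<m} \<times> {..<m}"
  by (auto simp: off_diagonal_def)

lemma finite_off_diagonal: "finite (off_diagonal m)"
  by (rule finite_subset[OF off_diagonal_subset]) auto

lemma line_holomorphic_discriminant: "line_holomorphic_on (discriminant m) D"
  using line_holomorphic_tuple_sum[OF finite_off_diagonal off_diagonal_subset, of m "\<lambda>_. 0"]
  by (simp add: discriminant_def)

lemma off_diagonal_prod_not_inj: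
  assumes "\<not> inj_on x {..<m}"
  shows "(\<Prod>p\<in>off_diagonal m. x (fst p) - x (snd p) :: complex) = 0"
proof -
  obtain i j where "i < m" "j < m" "i \<noteq> j" "x i = x j"
    using assms by (auto simp: inj_on_def)
  then show ?thesis
    by (intro prod_zero[OF finite_off_diagonal]) (auto simp: off_diagonal_def)
qed

lemma discriminant_eq_0:
  assumes "z \<in> D" "card (zeros z) < m"
  shows "discriminant m z = 0"
  unfolding discriminant_def tuple_sum_def
proof (rule sum.neutral, rule ballI)
  fix x assume "x \<in> PiE {..<m} (\<lambda>_. zeros z)"
  then have "x ` {..<m} \<subseteq> zeros z"
    by auto
  then have "\<not> inj_on x {..<m}"
    using assms card_inj_on_le[of x "{..<m}" "zeros z"] finite_zeros by auto
  then show "(\<Prod>i<m. of_nat (zero_mult z (x i))) * (\<Prod>p\<in>off_diagonal m. x (fst p) - x (snd p)) = 0"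
    using off_diagonal_prod_not_inj by simp
qed

text \<open>With exactly \<open>m\<close> distinct zeros, every injective tuple is a numbering of
  all of them. Since the product runs over ordered pairs, it does not depend on the numbering, so
  all injective tuples contribute the same nonzero \<open>c\<close> and nothing cancels.\<close>

lemma discriminant_nonzero:
  assumes "z \<in> D" "card (zeros z) = m"
  shows "discriminant m z \<noteq> 0"
proof -
  define E where "E = PiE {..<m} (\<lambda>_. zeros z)"
  define c :: complex where "c = (\<Prod>w\<in>zeros z. of_nat (zero_mult z w)) *
    (\<Prod>p\<in>{(w, w'). w \<in> zeros z \<and> w' \<in> zeros z \<and> w \<noteq> w'}. fst p - snd p)"
  note fin = finite_zeros[OF assms(1)]
  have "finite E"
    unfolding E_def using fin by (intro finite_PiE) auto
  have "c \<noteq> 0"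
  proof -
    have "finite {(w, w'). w \<in> zeros z \<and> w' \<in> zeros z \<and> w \<noteq> w'}"
      by (rule finite_subset[of _ "zeros z \<times> zeros z"]) (use fin in auto)
    then show ?thesis
      unfolding c_def using fin zero_mult_pos[OF assms(1)] by auto
  qed
  have summand: "(\<Prod>i<m. of_nat (zero_mult z (x i))) * (\<Prod>p\<in>off_diagonal m. x (fst p) - x (snd p)) =
      (if inj_on x {..<m} then c else 0)" if "x \<in> E" for x
  proof (cases "inj_on x {..<m}")
    case True
    have sub: "x ` {..<m} \<subseteq> zeros z"
      using that by (auto simp: E_def)
    moreover have "card (x ` {..<m}) = card (zeros z)"
      using True assms by (simp add: card_image)
    ultimately have "x ` {..<m} = zeros z"
      using fin by (simp add: card_subset_eq)
    with True have bij: "bij_betw x {..<m} (zeros z)"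
      by (simp add: bij_betw_def)
    have "(\<Prod>i<m. of_nat (zero_mult z (x i))) = (\<Prod>w\<in>zeros z. of_nat (zero_mult z w) :: complex)"
      by (rule prod.reindex_bij_betw[OF bij])
    moreover have "bij_betw (map_prod x x) (off_diagonal m) {(w, w'). w \<in> zeros z \<and> w' \<in> zeros z \<and> w \<noteq> w'}"
    proof (rule bij_betw_imageI)
      show "inj_on (map_prod x x) (off_diagonal m)"
        using True by (auto simp: inj_on_def off_diagonal_def)
      show "map_prod x x ` off_diagonal m = {(w, w'). w \<in> zeros z \<and> w' \<in> zeros z \<and> w \<noteq> w'}"
      proof (intro equalityI subsetI)
        fix p assume "p \<in> {(w, w'). w \<in> zeros z \<and> w' \<in> zeros z \<and> w \<noteq> w'}"
        then obtain i j where "i < m" "j < m" "p = (x i, x j)" "x i \<noteq> x j"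
          using \<open>x ` {..<m} = zeros z\<close>[symmetric] by auto
        then show "p \<in> map_prod x x ` off_diagonal m"
          by (intro rev_image_eqI[of "(i, j)"]) (auto simp: off_diagonal_def)
      next
        fix p assume "p \<in> map_prod x x ` off_diagonal m"
        then show "p \<in> {(w, w'). w \<in> zeros z \<and> w' \<in> zeros z \<and> w \<noteq> w'}"
          using sub True by (auto simp: off_diagonal_def inj_on_eq_iff)
      qed
    qed
    then have "(\<Prod>p\<in>off_diagonal m. fst (map_prod x x p) - snd (map_prod x x p)) =
        (\<Prod>p\<in>{(w, w'). w \<in> zeros z \<and> w' \<in> zeros z \<and> w \<noteq> w'}. fst p - snd p)"
      by (rule prod.reindex_bij_betw)
    ultimately show ?thesis
      using True by (simp add: c_def)
  qed (simp add: off_diagonal_prod_not_inj)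
  have "discriminant m z = (\<Sum>x\<in>E. if inj_on x {..<m} then c else 0)"
    unfolding discriminant_def tuple_sum_def E_def[symmetric] by (rule sum.cong[OF refl summand])
  also have "\<dots> = of_nat (card {x\<in>E. inj_on x {..<m}}) * c"
    using \<open>finite E\<close> by (simp add: sum.If_cases Int_def)
  finally have eq: "discriminant m z = of_nat (card {x\<in>E. inj_on x {..<m}}) * c" .
  obtain x where x: "bij_betw x {..<m} (zeros z)"
    using ex_bij_betw_nat_finite[OF fin] assms(2) by (auto simp: lessThan_atLeast0)
  have "restrict x {..<m} \<in> {x\<in>E. inj_on x {..<m}}"
    using x by (auto simp: E_def bij_betw_def inj_on_restrict_eq)
  then have "card {x\<in>E. inj_on x {..<m}} \<noteq> 0"
    using \<open>finite E\<close> by (auto simp: card_eq_0_iff)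
  with eq \<open>c \<noteq> 0\<close> show ?thesis
    by simp
qed

text \<open>\<open>m\<close> is the largest number of distinct zeros over \<open>D\<close>; it
  exists because the constant total multiplicity bounds all these numbers.\<close>

lemma generic_number_of_zeros:
  assumes "connected D" "D \<noteq> {}"
  obtains m p where "p \<in> D" "discriminant m p \<noteq> 0" "\<And>z. z \<in> D \<Longrightarrow> card (zeros z) \<le> m"
    "\<And>z. z \<in> D \<Longrightarrow> discriminant m z \<noteq> 0 \<longleftrightarrow> card (zeros z) = m"
proof -
  obtain z0 where z0: "z0 \<in> D"
    using assms by blast
  define m where "m = Max ((\<lambda>z. card (zeros z)) ` D)"
  have "(\<lambda>z. card (zeros z)) ` D \<subseteq> {..\<Sum>w\<in>zeros z0. zero_mult z0 w}"
    using card_zeros_le sum_zero_mult_constant[OF assms(1) z0] by fastforce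
  then have fin: "finite ((\<lambda>z. card (zeros z)) ` D)"
    by (rule finite_subset) simp
  then have "m \<in> (\<lambda>z. card (zeros z)) ` D"
    unfolding m_def using assms by (intro Max_in) auto
  then obtain p where p: "p \<in> D" "card (zeros p) = m"
    by blast
  have le: "card (zeros z) \<le> m" if "z \<in> D" for z
    unfolding m_def using fin that by (intro Max_ge) auto
  show ?thesis
  proof
    show "p \<in> D" "discriminant m p \<noteq> 0"
      using p discriminant_nonzero by auto
    show "discriminant m z \<noteq> 0 \<longleftrightarrow> card (zeros z) = m" if "z \<in> D" for z
      using le[OF that] discriminant_eq_0[OF that, of m] discriminant_nonzero[OF that] by fastforce
  qed (rule le)
qed

end

section \<open>Holomorphic root functions\<close>

text \<open>Asking for all radii below a threshold, and not for one radius, makes the condition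
  survive taking the minimum over \<open>Z\<close>.\<close>

lemma finite_uniform_radius:
  assumes "finite Z" "\<And>w. w \<in> Z \<Longrightarrow> \<exists>e>0. \<forall>\<epsilon>. 0 < \<epsilon> \<and> \<epsilon> \<le> e \<longrightarrow> P w (\<epsilon> :: real)"
  obtains e where "e > 0" "\<And>w \<epsilon>. w \<in> Z \<Longrightarrow> 0 < \<epsilon> \<Longrightarrow> \<epsilon> \<le> e \<Longrightarrow> P w \<epsilon>"
proof -
  have "\<exists>e>0. \<forall>w\<in>Z. \<forall>\<epsilon>. 0 < \<epsilon> \<and> \<epsilon> \<le> e \<longrightarrow> P w \<epsilon>"
    using assms
  proof (induction Z rule: finite_induct)
    case empty
    then show ?case by (intro exI[of _ 1]) auto
  next
    case (insert x Z)
    then obtain e where e: "e > 0" "\<forall>w\<in>Z. \<forall>\<epsilon>. 0 < \<epsilon> \<and> \<epsilon> \<le> e \<longrightarrow> P w \<epsilon>"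
      by auto
    obtain e' where e': "e' > 0" "\<forall>\<epsilon>. 0 < \<epsilon> \<and> \<epsilon> \<le> e' \<longrightarrow> P x \<epsilon>"
      using insert.prems by blast
    show ?case
      using e e' by (intro exI[of _ "min e e'"]) auto
  qed
  with that show ?thesis by blast
qed

lemma finite_separating_radius:
  assumes "finite Z" "w \<in> Z" "w \<in> \<Omega>" "open (\<Omega> :: complex set)"
  shows "\<exists>e>0. \<forall>\<epsilon>. 0 < \<epsilon> \<and> \<epsilon> \<le> e \<longrightarrow> cball w \<epsilon> \<subseteq> \<Omega> \<and> (\<forall>w'\<in>Z. w \<noteq> w' \<longrightarrow> cball w \<epsilon> \<inter> cball w' \<epsilon> = {})"
proof -
  obtain d where d: "d > 0" "\<forall>w'\<in>Z. w' \<noteq> w \<longrightarrow> d \<le> dist w w'"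
    using finite_set_avoid[OF assms(1), of w] by blast
  obtain e where e: "e > 0" "cball w e \<subseteq> \<Omega>"
    using assms open_contains_cball by blast
  show ?thesis
  \<comment> \<open>Two radii of at most \<open>d/3\<close> add up to less than the distance
    \<open>d\<close>.\<close>
  proof (intro exI[of _ "min e (d/3)"] conjI allI impI ballI)
    fix \<epsilon> assume \<epsilon>: "0 < \<epsilon> \<and> \<epsilon> \<le> min e (d/3)"
    then show "cball w \<epsilon> \<subseteq> \<Omega>"
      using e subset_cball[of \<epsilon> e w] by auto
    fix w' assume "w' \<in> Z" "w \<noteq> w'"
    with d have "d \<le> dist w w'" by auto
    then show "cball w \<epsilon> \<inter> cball w' \<epsilon> = {}"
      using \<epsilon> d(1) by (intro disjoint_cballI) auto
  qed (use e d in auto)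
qed

lemma zeros_in_disc_subset:
  assumes "zeros_in_disc f U D v a \<rho>" "open D'" "D' \<subseteq> D"
  shows "zeros_in_disc f U D' v a \<rho>"
  using assms unfolding zeros_in_disc_def by blast

lemma zeros_in_disc_ball:
  assumes f: "line_holomorphic_on f U" and "\<rho> > 0" "\<And>w. w \<in> cball a \<rho> \<Longrightarrow> b + w *s v \<in> U"
    and "\<And>w. w \<in> sphere a \<rho> \<Longrightarrow> f (b + w *s v) \<noteq> 0"
  obtains r where "r > 0" "zeros_in_disc f U (ball b r) v a \<rho>"
proof -
  note U = line_holomorphic_onD[OF f]
  obtain r1 where r1: "r1 > 0" "\<And>z w. z \<in> ball b r1 \<Longrightarrow> w \<in> cball a \<rho> \<Longrightarrow> z + w *s v \<in> U"
    by (rule line_tube[OF U(1) compact_cball assms(3)]) blast+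
  obtain r2 where r2: "r2 > 0" "\<And>z w. z \<in> ball b r2 \<Longrightarrow> w \<in> sphere a \<rho> \<Longrightarrow> z + w *s v \<in> {z\<in>U. f z \<noteq> 0}"
    by (rule line_tube[OF line_holomorphic_open_nonzero[OF f] compact_sphere, of a \<rho> b v]) (use assms in auto)
  have "zeros_in_disc f U (ball b (min r1 r2)) v a \<rho>"
    by unfold_locales (use f \<open>\<rho> > 0\<close> r1 r2 in auto)
  with r1 r2 that[of "min r1 r2"] show ?thesis
    by auto
qed

context zeros_in_disc
begin

text \<open>Around each zero over \<open>z0\<close> a small disc keeps at least one zero over nearby
  points. As \<open>z0\<close> has the largest number of distinct zeros, no disc can hold two and
  none can lie outside the discs, so each disc defines a single-valued root.\<close>

lemma local_root_functions:
  assumes z0: "z0 \<in> D" and max: "\<And>z. z \<in> D \<Longrightarrow> card (zeros z) \<le> card (zeros z0)"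
  obtains r \<epsilon> \<alpha> where "r > 0" "\<epsilon> > 0" "ball z0 r \<subseteq> D"
    "\<And>w. w \<in> zeros z0 \<Longrightarrow> line_holomorphic_on (\<alpha> w) (ball z0 r)"
    "\<And>w z. w \<in> zeros z0 \<Longrightarrow> z \<in> ball z0 r \<Longrightarrow> zeros z \<inter> ball w \<epsilon> = {\<alpha> w z}"
    "\<And>z. z \<in> ball z0 r \<Longrightarrow> zeros z = (\<lambda>w. \<alpha> w z) ` zeros z0"
    "\<And>z. z \<in> ball z0 r \<Longrightarrow> inj_on (\<lambda>w. \<alpha> w z) (zeros z0)"
proof -
  note fin = finite_zeros[OF z0]
  obtain \<epsilon> where \<epsilon>: "\<epsilon> > 0" "\<And>w. w \<in> zeros z0 \<Longrightarrow> cball w \<epsilon> \<subseteq> ball a \<rho>"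
    "\<And>w w'. w \<in> zeros z0 \<Longrightarrow> w' \<in> zeros z0 \<Longrightarrow> w \<noteq> w' \<Longrightarrow> cball w \<epsilon> \<inter> cball w' \<epsilon> = {}"
  proof (rule finite_uniform_radius[OF fin])
    show "\<exists>e>0. \<forall>\<epsilon>. 0 < \<epsilon> \<and> \<epsilon> \<le> e \<longrightarrow> cball w \<epsilon> \<subseteq> ball a \<rho> \<and>
        (\<forall>w'\<in>zeros z0. w \<noteq> w' \<longrightarrow> cball w \<epsilon> \<inter> cball w' \<epsilon> = {})" if "w \<in> zeros z0" for w
      by (rule finite_separating_radius[OF fin that]) (use that in \<open>auto simp: zeros_def\<close>)
  qed auto
  obtain r1 where r1: "r1 > 0" "ball z0 r1 \<subseteq> D"
    using open_D z0 open_contains_ball by blast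
  obtain r2 where r2: "r2 > 0" "\<And>w r. w \<in> zeros z0 \<Longrightarrow> 0 < r \<Longrightarrow> r \<le> r2 \<Longrightarrow> zeros_in_disc f U (ball z0 r) v w \<epsilon>"
  proof (rule finite_uniform_radius[OF fin])
    fix w assume w: "w \<in> zeros z0"
    obtain r where r: "r > 0" "zeros_in_disc f U (ball z0 r) v w \<epsilon>"
    proof (rule zeros_in_disc_ball[OF line_holomorphic \<open>\<epsilon> > 0\<close>])
      show "z0 + x *s v \<in> U" if "x \<in> cball w \<epsilon>" for x
        using \<epsilon>(2)[OF w] that z0 by (intro disc_in_U) auto
      show "f (z0 + x *s v) \<noteq> 0" if x: "x \<in> sphere w \<epsilon>" for x
      proof
        assume "f (z0 + x *s v) = 0"
        moreover have "x \<in> ball a \<rho>"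
          using \<epsilon>(2)[OF w] x by auto
        ultimately have "x \<in> zeros z0"
          by (simp add: zeros_def)
        moreover have "x \<noteq> w"
          using x \<epsilon>(1) by auto
        ultimately show False
          using \<epsilon>(3)[OF w, of x] x \<epsilon>(1) by auto
      qed
    qed
    then show "\<exists>e>0. \<forall>r. 0 < r \<and> r \<le> e \<longrightarrow> zeros_in_disc f U (ball z0 r) v w \<epsilon>"
      by (intro exI[of _ r]) (auto intro: zeros_in_disc_subset)
  qed auto
  define r where "r = min r1 r2"
  have r: "r > 0" "ball z0 r \<subseteq> D"
    using r1 r2 by (auto simp: r_def)
  have small: "zeros_in_disc f U (ball z0 r) v w \<epsilon>" if "w \<in> zeros z0" for w
    using r1 r2 that by (auto simp: r_def)
  define Zs where "Zs w z = {x\<in>ball w \<epsilon>. f (z + x *s v) = 0}" for w z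
  have Zs_def': "zeros_in_disc.zeros f v w \<epsilon> z = Zs w z" if "w \<in> zeros z0" for w z
    using zeros_in_disc.zeros_def[OF small[OF that]] by (simp add: Zs_def)
  \<comment> \<open>A single zero \<open>x\<close> of multiplicity \<open>k\<close> in the small
    disc has power sums \<open>k * x\<close> and \<open>k\<close>; their quotient is the zero, and
    it is holomorphic in the base point even if \<open>k > 1\<close>.\<close>
  define \<alpha> where "\<alpha> w z = zeros_in_disc.power_sum f v w \<epsilon> 1 z / zeros_in_disc.power_sum f v w \<epsilon> 0 z" for w z
  have Zs_zeros: "zeros z \<inter> ball w \<epsilon> = Zs w z" if "w \<in> zeros z0" for w z
    using \<epsilon>(2)[OF that] ball_subset_cball[of w \<epsilon>] unfolding zeros_def Zs_def by blast
  have Zs_ne: "Zs w z \<noteq> {}" if w: "w \<in> zeros z0" and z: "z \<in> ball z0 r" for w z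
  proof -
    have "w \<in> Zs w z0"
      using w \<epsilon>(1) by (auto simp: Zs_def zeros_def)
    then show ?thesis
      using zeros_in_disc.zeros_nonempty[OF small[OF w], of z0 z] Zs_def'[OF w] z r by auto
  qed
  define sel where "sel z w = (SOME x. x \<in> Zs w z)" for z w
  have sel: "zeros z = sel z ` zeros z0" "inj_on (sel z) (zeros z0)" "\<And>w. w \<in> zeros z0 \<Longrightarrow> Zs w z = {sel z w}"
    if z: "z \<in> ball z0 r" for z
  proof -
    have in_Zs: "sel z w \<in> Zs w z" if "w \<in> zeros z0" for w
      unfolding sel_def using Zs_ne[OF that z] by (simp add: some_in_eq)
    have disj: "w = w'" if "w \<in> zeros z0" "w' \<in> zeros z0" "x \<in> Zs w z" "x \<in> Zs w' z" for w w' x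
    proof -
      have "x \<in> cball w \<epsilon> \<inter> cball w' \<epsilon>"
        using that(3,4) by (auto simp: Zs_def)
      with \<epsilon>(3)[OF that(1,2)] show ?thesis
        by blast
    qed
    show inj: "inj_on (sel z) (zeros z0)"
      by (rule inj_onI) (metis in_Zs disj)
    have "z \<in> D"
      using z r by auto
    have "sel z ` zeros z0 \<subseteq> zeros z"
      using in_Zs Zs_zeros by blast
    \<comment> \<open>Pigeonhole: the selected zeros already reach the maximal number.\<close>
    moreover have "card (zeros z) \<le> card (sel z ` zeros z0)"
      using max[OF \<open>z \<in> D\<close>] inj by (simp add: card_image)
    ultimately show eq: "zeros z = sel z ` zeros z0"
      using finite_zeros[OF \<open>z \<in> D\<close>] by (metis card_seteq)
    show "Zs w z = {sel z w}" if w: "w \<in> zeros z0" for w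
    proof (intro equalityI subsetI)
      fix x assume x: "x \<in> Zs w z"
      then have "x \<in> zeros z"
        using Zs_zeros[OF w] by blast
      then obtain w' where w': "w' \<in> zeros z0" "x = sel z w'"
        using eq by blast
      with in_Zs[of w'] disj[OF w w'(1) x] show "x \<in> {sel z w}"
        by simp
    qed (use in_Zs[OF w] in auto)
  qed
  have \<alpha>: "\<alpha> w z = sel z w" and nz: "zeros_in_disc.power_sum f v w \<epsilon> 0 z \<noteq> 0"
    if w: "w \<in> zeros z0" and z: "z \<in> ball z0 r" for w z
  proof -
    interpret small: zeros_in_disc f U "ball z0 r" v w \<epsilon>
      by (rule small[OF w])
    have Z: "small.zeros z = {sel z w}"
      using Zs_def'[OF w] sel(3)[OF z w] by simp
    then have "small.zero_mult z (sel z w) > 0"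
      using small.zero_mult_pos[OF z] by auto
    then show "\<alpha> w z = sel z w" "small.power_sum 0 z \<noteq> 0"
      by (simp_all add: \<alpha>_def small.power_sum_def Z)
  qed
  show ?thesis
  proof (rule that[of r \<epsilon> \<alpha>])
    show "line_holomorphic_on (\<alpha> w) (ball z0 r)" if w: "w \<in> zeros z0" for w
      unfolding \<alpha>_def using nz[OF w]
      by (intro line_holomorphic_on_divide zeros_in_disc.line_holomorphic_power_sum[OF small[OF w]])
    fix z assume z: "z \<in> ball z0 r"
    show "zeros z \<inter> ball w \<epsilon> = {\<alpha> w z}" if w: "w \<in> zeros z0" for w
      using Zs_zeros[OF w] sel(3)[OF z w] \<alpha>[OF w z] by simp
    show "zeros z = (\<lambda>w. \<alpha> w z) ` zeros z0"
      using sel(1)[OF z] \<alpha>[OF _ z] by (simp cong: image_cong)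
    show "inj_on (\<lambda>w. \<alpha> w z) (zeros z0)"
      using sel(2)[OF z] \<alpha>[OF _ z] by (simp cong: inj_on_cong)
  qed (use r \<epsilon> in auto)
qed

end

subsection \<open>Entire functions of polynomial growth\<close>

definition polynomial_fun :: "(complex ^ 'n \<Rightarrow> complex) \<Rightarrow> bool" where
  "polynomial_fun f \<longleftrightarrow> (\<exists>P. \<forall>z. f z = mpoly_eval P z)"

lemma mpoly_eval_superset:
  assumes "finite K" "Poly_Mapping.keys P \<subseteq> K"
  shows "mpoly_eval P z = (\<Sum>m\<in>K. Poly_Mapping.lookup P m * (\<Prod>i\<in>UNIV. (z $ i) ^ Poly_Mapping.lookup m i))"
  unfolding mpoly_eval_def
  by (rule sum.mono_neutral_left) (use assms in \<open>auto simp: in_keys_iff\<close>)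

lemma polynomial_fun_add:
  assumes "polynomial_fun f" "polynomial_fun g"
  shows "polynomial_fun (\<lambda>z. f z + g z)"
proof -
  obtain P Q where PQ: "\<And>z. f z = mpoly_eval P z" "\<And>z. g z = mpoly_eval Q z"
    using assms unfolding polynomial_fun_def by blast
  let ?K = "Poly_Mapping.keys P \<union> Poly_Mapping.keys Q"
  have K: "Poly_Mapping.keys (P + Q) \<subseteq> ?K"
    by (rule Poly_Mapping.keys_add)
  have "f z + g z = mpoly_eval (P + Q) z" for z
    unfolding PQ
    by (subst (1 2 3) mpoly_eval_superset[of ?K]) (use K in \<open>auto simp: lookup_add sum.distrib distrib_right\<close>)
  then show ?thesis
    unfolding polynomial_fun_def by blast
qed

lemma polynomial_fun_monomial:
  "polynomial_fun (\<lambda>z :: complex ^ 'n. c * (\<Prod>i\<in>UNIV. (z $ i) ^ Poly_Mapping.lookup m i))"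
  unfolding polynomial_fun_def
proof (intro exI[of _ "Poly_Mapping.single m c"] allI)
  fix z :: "complex ^ 'n"
  show "c * (\<Prod>i\<in>UNIV. (z $ i) ^ Poly_Mapping.lookup m i) = mpoly_eval (Poly_Mapping.single m c) z"
    by (subst mpoly_eval_superset[of "{m}"]) auto
qed

lemma polynomial_fun_const: "polynomial_fun (\<lambda>_. c)"
  using polynomial_fun_monomial[of c 0] by simp

lemma polynomial_fun_sum:
  assumes "finite A" "\<And>a. a \<in> A \<Longrightarrow> polynomial_fun (f a)"
  shows "polynomial_fun (\<lambda>z. \<Sum>a\<in>A. f a z)"
  using assms by (induction A rule: finite_induct) (auto intro: polynomial_fun_add polynomial_fun_const)

lemma polynomial_fun_cmult:
  assumes "polynomial_fun f"
  shows "polynomial_fun (\<lambda>z. c * f z)"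
proof -
  obtain P where P: "\<And>z. f z = mpoly_eval P z"
    using assms unfolding polynomial_fun_def by blast
  have "polynomial_fun (\<lambda>z. \<Sum>m\<in>Poly_Mapping.keys P. (c * Poly_Mapping.lookup P m) *
      (\<Prod>i\<in>UNIV. (z $ i) ^ Poly_Mapping.lookup m i))"
    by (intro polynomial_fun_sum polynomial_fun_monomial) auto
  then show ?thesis
    by (simp add: P mpoly_eval_def sum_distrib_left mult.assoc)
qed

lemma polynomial_fun_coordinate_mult:
  fixes f :: "complex ^ 'n \<Rightarrow> complex"
  assumes "polynomial_fun f"
  shows "polynomial_fun (\<lambda>z. z $ x * f z)"
proof -
  obtain P where P: "\<And>z. f z = mpoly_eval P z"
    using assms unfolding polynomial_fun_def by blast
  have shift: "(\<Prod>i\<in>UNIV. (z $ i) ^ Poly_Mapping.lookup (m + Poly_Mapping.single x 1) i) =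
      z $ x * (\<Prod>i\<in>UNIV. (z $ i) ^ Poly_Mapping.lookup m i)" for z :: "complex ^ 'n" and m
  proof -
    have "(\<Prod>i\<in>UNIV. (z $ i) ^ Poly_Mapping.lookup (m + Poly_Mapping.single x 1) i) =
        (\<Prod>i\<in>UNIV. (if i = x then z $ x else 1) * (z $ i) ^ Poly_Mapping.lookup m i)"
      by (intro prod.cong) (auto simp: lookup_add lookup_single when_def)
    then show ?thesis
      by (simp add: prod.distrib)
  qed
  have "polynomial_fun (\<lambda>z. \<Sum>m\<in>Poly_Mapping.keys P. Poly_Mapping.lookup P m *
      (\<Prod>i\<in>UNIV. (z $ i) ^ Poly_Mapping.lookup (m + Poly_Mapping.single x 1) i))"
    by (intro polynomial_fun_sum polynomial_fun_monomial) auto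
  then show ?thesis
    unfolding shift by (simp add: P mpoly_eval_def sum_distrib_left mult.left_commute)
qed

lemma polynomial_fun_poly_mult:
  assumes "polynomial_fun f"
  shows "polynomial_fun (\<lambda>z. f z * poly p (z $ x))"
proof (induction p)
  case 0
  then show ?case by (simp add: polynomial_fun_const)
next
  case (pCons a p)
  have "polynomial_fun (\<lambda>z. a * f z + z $ x * (f z * poly p (z $ x)))"
    by (intro polynomial_fun_add polynomial_fun_cmult polynomial_fun_coordinate_mult assms pCons)
  then show ?case
    by (simp add: algebra_simps)
qed

section \<open>Interpolation and polynomials in each coordinate\<close>

definition lagrange_basis :: "nat \<Rightarrow> nat \<Rightarrow> complex poly" where
  "lagrange_basis N k = (\<Prod>j\<in>{..N} - {k}. [:- of_nat j / (of_nat k - of_nat j), 1 / (of_nat k - of_nat j):])"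

lemma poly_lagrange_basis:
  assumes "j \<le> N" "k \<le> N"
  shows "poly (lagrange_basis N k) (of_nat j) = (if j = k then 1 else 0)"
proof (cases "j = k")
  case True
  have "poly (lagrange_basis N k) (of_nat k) = (\<Prod>i\<in>{..N} - {k}. 1)"
    unfolding lagrange_basis_def poly_prod
  proof (rule prod.cong)
    fix i assume "i \<in> {..N} - {k}"
    then have "of_nat k - of_nat i \<noteq> (0 :: complex)"
      by simp
    then show "poly [:- of_nat i / (of_nat k - of_nat i), 1 / (of_nat k - of_nat i):] (of_nat k) = (1 :: complex)"
      by (simp add: divide_simps)
  qed simp
  then show ?thesis
    using True by simp
next
  case False
  then show ?thesis
    using assms unfolding lagrange_basis_def poly_prod by (auto intro!: prod_zero bexI[of _ j])
qed

lemma degree_lagrange_basis: "k \<le> N \<Longrightarrow> degree (lagrange_basis N k) \<le> N"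
proof -
  assume k: "k \<le> N"
  have "degree (lagrange_basis N k) \<le> (\<Sum>j\<in>{..N} - {k}. degree [:- of_nat j / (of_nat k - of_nat j), 1 / (of_nat k - of_nat j) :: complex:])"
    unfolding lagrange_basis_def by (rule degree_prod_sum_le[unfolded comp_def]) simp
  also have "\<dots> \<le> (\<Sum>j\<in>{..N} - {k}. 1)"
    by (intro sum_mono) (simp add: degree_pCons_le)
  finally show ?thesis
    using k by simp
qed

lemma lagrange_interpolation:
  assumes "degree p \<le> N"
  shows "poly p t = (\<Sum>k\<le>N. poly p (of_nat k) * poly (lagrange_basis N k) t)"
proof -
  define q where "q = (\<Sum>k\<le>N. smult (poly p (of_nat k)) (lagrange_basis N k))"
  have "degree q \<le> N"
    unfolding q_def by (intro degree_sum_le) (auto intro: order.trans[OF degree_smult_le] degree_lagrange_basis)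
  have inj: "inj_on (of_nat :: nat \<Rightarrow> complex) {..N}"
    by (simp add: inj_on_def)
  have "p = q"
  proof (rule poly_eqI_degree[of "of_nat ` {..N}"])
    fix x :: complex assume "x \<in> of_nat ` {..N}"
    then obtain j where j: "j \<le> N" "x = of_nat j"
      by auto
    have "poly q x = (\<Sum>k\<le>N. poly p (of_nat k) * (if j = k then 1 else 0))"
      unfolding q_def poly_sum poly_smult j(2)
      by (intro sum.cong refl arg_cong2[of _ _ _ _ "(*)"] poly_lagrange_basis) (use j in auto)
    also have "\<dots> = poly p x"
      using j by (simp add: if_distrib[of "\<lambda>c. _ * c"] cong: if_cong)
    finally show "poly p x = poly q x" by simp
  qed (use assms \<open>degree q \<le> N\<close> inj in \<open>auto simp: card_image\<close>)
  then show ?thesis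
    by (metis (no_types, lifting) q_def poly_sum poly_smult sum.cong)
qed

definition coord_upd :: "complex ^ 'n \<Rightarrow> 'n \<Rightarrow> complex \<Rightarrow> complex ^ 'n" where
  "coord_upd z i t = (\<chi> j. if j = i then t else z $ j)"

text \<open>Interpolating in one coordinate at the nodes \<open>0\<close> to \<open>N\<close> writes
  \<open>g\<close> as a combination of basis polynomials whose coefficients are \<open>g\<close>
  with that coordinate frozen, thus functions of fewer coordinates. The degree bound is uniform in
  \<open>z\<close>, so the same nodes serve everywhere; the induction is on a set of coordinates
  that determine \<open>g\<close>.\<close>

lemma polynomial_fun_if_polynomial_in_each_coordinate:
  fixes g :: "complex ^ 'n \<Rightarrow> complex"
  assumes "\<And>z i. \<exists>p. degree p \<le> N \<and> (\<forall>t. g (coord_upd z i t) = poly p t)"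
  shows "polynomial_fun g"
proof -
  have claim: "polynomial_fun g" if "finite S"
    "\<And>z z'. (\<And>i. i \<in> S \<Longrightarrow> z $ i = z' $ i) \<Longrightarrow> g z = g z'"
    "\<And>z i. \<exists>p. degree p \<le> N \<and> (\<forall>t. g (coord_upd z i t) = poly p t)" for S :: "'n set" and g
    using that
  proof (induction S arbitrary: g rule: finite_induct)
    case empty
    then have "g = (\<lambda>_. g 0)"
      by blast
    then show ?case
      by (metis polynomial_fun_const)
  next
    case (insert x S)
    have "polynomial_fun (\<lambda>z. g (coord_upd z x (of_nat k)))" for k
    proof (rule insert.IH)
      show "g (coord_upd z x (of_nat k)) = g (coord_upd z' x (of_nat k))" if "\<And>i. i \<in> S \<Longrightarrow> z $ i = z' $ i" for z z'
        by (rule insert.prems(1)) (use that in \<open>auto simp: coord_upd_def\<close>)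
      show "\<exists>p. degree p \<le> N \<and> (\<forall>t. g (coord_upd (coord_upd z i t) x (of_nat k)) = poly p t)" for z i
      proof (cases "i = x")
        case True
        then have "coord_upd (coord_upd z i t) x (of_nat k) = coord_upd z x (of_nat k)" for t
          by (simp add: coord_upd_def vec_eq_iff)
        then show ?thesis
          by (intro exI[of _ "[:g (coord_upd z x (of_nat k)):]"]) simp
      next
        case False
        then have "coord_upd (coord_upd z i t) x (of_nat k) = coord_upd (coord_upd z x (of_nat k)) i t" for t
          by (auto simp: coord_upd_def vec_eq_iff)
        then show ?thesis
          using insert.prems(2)[of "coord_upd z x (of_nat k)" i] by simp
      qed
    qed
    then have "polynomial_fun (\<lambda>z. \<Sum>k\<le>N. g (coord_upd z x (of_nat k)) * poly (lagrange_basis N k) (z $ x))"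
      by (intro polynomial_fun_sum polynomial_fun_poly_mult) auto
    moreover have "(\<lambda>z. \<Sum>k\<le>N. g (coord_upd z x (of_nat k)) * poly (lagrange_basis N k) (z $ x)) = g"
    proof
      fix z
      obtain p where p: "degree p \<le> N" "\<And>t. g (coord_upd z x t) = poly p t"
        using insert.prems(2) by blast
      have "coord_upd z x (z $ x) = z"
        by (simp add: coord_upd_def vec_eq_iff)
      then show "(\<Sum>k\<le>N. g (coord_upd z x (of_nat k)) * poly (lagrange_basis N k) (z $ x)) = g z"
        using lagrange_interpolation[OF p(1), of "z $ x"] p(2)[of "z $ x"] by (simp add: p(2))
    qed
    ultimately show ?case
      by simp
  qed
  show ?thesis
  proof (rule claim[of UNIV])
    show "g z = g z'" if "\<And>i. i \<in> UNIV \<Longrightarrow> z $ i = z' $ i" for z z' :: "complex ^ 'n"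
      using that by (intro arg_cong[of _ _ g]) (simp add: vec_eq_iff)
  qed (use assms in auto)
qed

theorem polynomial_fun_of_polynomial_growth:
  fixes g :: "complex ^ 'n \<Rightarrow> complex"
  assumes g: "line_holomorphic_on g UNIV" and growth: "\<And>z. norm (g z) \<le> (C * (1 + norm z)) ^ N" and "C \<ge> 0"
  shows "polynomial_fun g"
proof (rule polynomial_fun_if_polynomial_in_each_coordinate)
  fix z :: "complex ^ 'n" and i
  define z0 where "z0 = coord_upd z i 0"
  have upd: "coord_upd z i t = z0 + t *s axis i 1" for t
    by (simp add: z0_def coord_upd_def axis_def vec_eq_iff)
  define h where "h t = g (z0 + t *s axis i 1)" for t
  have hol: "h holomorphic_on UNIV"
    using line_holomorphic_onD(3)[OF g, of z0 "axis i 1"] by (simp add: h_def[abs_def])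
  \<comment> \<open>Liouville's theorem asks for growth only away from the origin; for
    \<open>1 \<le> norm t\<close> the terms \<open>1\<close> and \<open>norm z0\<close> are absorbed
    into multiples of \<open>norm t\<close>, which gives the factor
    \<open>2 + norm z0\<close>.\<close>
  have bound: "norm (h t) \<le> (C * (2 + norm z0)) ^ N * norm t ^ N" if "1 \<le> norm t" for t
  proof -
    have "norm (z0 + t *s axis i 1) \<le> norm z0 + norm t"
      using norm_triangle_ineq[of z0 "t *s axis i 1"] by (simp add: norm_smult norm_axis_1)
    also have "1 + (norm z0 + norm t) \<le> (2 + norm z0) * norm t"
      using that mult_left_mono[OF that, of "norm z0"] by (simp add: algebra_simps)
    finally have "C * (1 + norm (z0 + t *s axis i 1)) \<le> C * ((2 + norm z0) * norm t)"
      using \<open>C \<ge> 0\<close> by (intro mult_left_mono) auto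
    then have "(C * (1 + norm (z0 + t *s axis i 1))) ^ N \<le> (C * ((2 + norm z0) * norm t)) ^ N"
      using \<open>C \<ge> 0\<close> by (intro power_mono) auto
    then show ?thesis
      using growth[of "z0 + t *s axis i 1"] by (simp add: h_def power_mult_distrib mult.assoc)
  qed
  define p where "p = (\<Sum>k\<le>N. monom ((deriv ^^ k) h 0 / fact k) k)"
  have "degree p \<le> N"
    unfolding p_def by (intro degree_sum_le) (auto intro: order.trans[OF degree_monom_le])
  moreover have "h t = poly p t" for t
    using Liouville_polynomial[OF hol bound, where \<xi> = t] by (simp add: p_def poly_sum poly_monom)
  ultimately show "\<exists>p. degree p \<le> N \<and> (\<forall>t. g (coord_upd z i t) = poly p t)"
    unfolding upd h_def by blast
qed

subsection \<open>Hypersurfaces with bounded fibres in one direction\<close>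

text \<open>\<open>regular_dense\<close> is the form in which purity enters, and
  \<open>fibre_bound\<close> is the quantitative form of the line of \<open>v\<close> not being an
  asymptotic direction.\<close>

locale bounded_fibre_hypersurface =
  fixes X :: "(complex ^ 'n) set" and v :: "complex ^ 'n" and C :: real
  assumes closed_X: "closed X" and analytic_X: "analytic_subset X"
    and regular_dense: "\<And>p. p \<in> X \<Longrightarrow> CARD('n) - 1 \<in> regular_dims_near X p"
    and fibre_bound: "\<And>z w. z + w *s v \<in> X \<Longrightarrow> norm w \<le> C * (1 + norm z)"
begin

definition fibre :: "complex ^ 'n \<Rightarrow> complex set" where
  "fibre z = {w. z + w *s v \<in> X}"

lemma closed_fibre: "closed (fibre z)"
proof -
  have "open {w. z + w *s v \<in> - X}"
    by (rule open_line_vimage) (use closed_X in auto)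
  then show ?thesis
    by (simp add: fibre_def closed_def Compl_eq)
qed

text \<open>By the identity theorem, applied to the local equations of \<open>X\<close> along the
  line, the interior of a fibre is closed as well as open. The bound on the fibre excludes the whole
  plane.\<close>

lemma interior_fibre: "interior (fibre z) = {}"
proof -
  define A where "A = interior (fibre z)"
  have "w0 \<in> A" if w0: "w0 \<in> closure A" for w0
  proof -
    obtain U F where U: "open U" "z + w0 *s v \<in> U" "\<forall>f\<in>F. holomorphic_fun_on f U"
      "X \<inter> U = {z \<in> U. \<forall>f\<in>F. f z = 0}"
      using analytic_X[unfolded analytic_subset_def, rule_format, of "z + w0 *s v"] by blast
    have "open {w. z + w *s v \<in> U}" "w0 \<in> {w. z + w *s v \<in> U}"
      using U by (auto intro: open_line_vimage)
    then obtain e where e: "e > 0" "ball w0 e \<subseteq> {w. z + w *s v \<in> U}"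
      using open_contains_ball by meson
    have ne: "ball w0 e \<inter> A \<noteq> {}"
    proof -
      have "w0 \<in> ball w0 e \<inter> closure A"
        using w0 e(1) by simp
      then show ?thesis
        using open_Int_closure_eq_empty[OF open_ball, of w0 e A] by blast
    qed
    have "f (z + w *s v) = 0" if "f \<in> F" "w \<in> ball w0 e" for f w
    proof (rule analytic_continuation_open[OF _ _ ne _ _ _ _ _ that(2)])
      show "(\<lambda>w. f (z + w *s v)) holomorphic_on ball w0 e"
      proof (rule holomorphic_on_subset[OF line_holomorphic_onD(3) e(2)])
        show "line_holomorphic_on f U"
          using that U by (intro holomorphic_imp_line_holomorphic) auto
      qed
      show "f (z + w *s v) = 0" if w: "w \<in> ball w0 e \<inter> A" for w
      proof -
        have "w \<in> fibre z" "z + w *s v \<in> U"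
          using w interior_subset e(2) by (auto simp: A_def)
        then have "z + w *s v \<in> X \<inter> U"
          by (simp add: fibre_def)
        then show ?thesis using \<open>f \<in> F\<close> U(4) by blast
      qed
    qed (auto simp: A_def)
    then have "ball w0 e \<subseteq> fibre z"
      using e U(4) unfolding fibre_def by blast
    then show ?thesis
      unfolding A_def using e(1) interior_maximal[of "ball w0 e" "fibre z"] by auto
  qed
  then have "closed A"
    using closure_subset_eq by blast
  moreover have "open A"
    by (simp add: A_def)
  ultimately have "A = {} \<or> A = UNIV"
    using clopen by blast
  moreover have "A \<noteq> UNIV"
  proof
    assume "A = UNIV"
    then have "of_real (\<bar>C * (1 + norm z)\<bar> + 1) \<in> fibre z"
      using interior_subset A_def by blast
    then have "norm (of_real (\<bar>C * (1 + norm z)\<bar> + 1) :: complex) \<le> C * (1 + norm z)"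
      unfolding fibre_def by (intro fibre_bound) auto
    then show False
      by (simp only: norm_of_real)
  qed
  ultimately show ?thesis
    by (simp add: A_def)
qed

text \<open>A fibre contains no disc, so some point of the line near \<open>a\<close> is outside
  \<open>X\<close>, and one of the local equations is nonzero there. Restricted to the line, this
  equation has an isolated zero at \<open>a\<close>; off the line it may vanish on more than
  \<open>X\<close>.\<close>

lemma fibre_isolating_function:
  assumes "a \<in> fibre b"
  obtains f U r where "holomorphic_fun_on f U" "b + a *s v \<in> U" "\<And>z. z \<in> X \<inter> U \<Longrightarrow> f z = 0"
    "r > 0" "\<And>w. w \<in> ball a r \<Longrightarrow> b + w *s v \<in> U" "\<And>w. w \<in> ball a r - {a} \<Longrightarrow> f (b + w *s v) \<noteq> 0"
proof -
  obtain U F where U: "open U" "b + a *s v \<in> U" "\<forall>f\<in>F. holomorphic_fun_on f U"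
    "X \<inter> U = {z \<in> U. \<forall>f\<in>F. f z = 0}"
    using analytic_X[unfolded analytic_subset_def, rule_format, of "b + a *s v"] by blast
  have "open {w. b + w *s v \<in> U}" "a \<in> {w. b + w *s v \<in> U}"
    using U by (auto intro: open_line_vimage)
  then obtain e where e: "e > 0" "ball a e \<subseteq> {w. b + w *s v \<in> U}"
    using open_contains_ball by meson
  have "\<not> ball a e \<subseteq> fibre b"
    using interior_fibre[of b] e(1) interior_maximal[of "ball a e" "fibre b"] by auto
  then obtain \<beta> where \<beta>: "\<beta> \<in> ball a e" "b + \<beta> *s v \<notin> X"
    unfolding fibre_def by blast
  moreover have "b + \<beta> *s v \<in> U"
    using \<beta>(1) e(2) by blast
  ultimately obtain f where f: "f \<in> F" "f (b + \<beta> *s v) \<noteq> 0"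
    using U(4) by blast
  have hol: "(\<lambda>w. f (b + w *s v)) holomorphic_on ball a e"
    by (rule holomorphic_on_subset[OF line_holomorphic_onD(3) e(2)])
      (use f U holomorphic_imp_line_holomorphic in auto)
  have "f (b + a *s v) = 0"
    using assms U(2,4) f by (auto simp: fibre_def)
  then obtain r where r: "r > 0" "ball a r \<subseteq> ball a e" "\<And>w. w \<in> ball a r - {a} \<Longrightarrow> f (b + w *s v) \<noteq> 0"
    using isolated_zeros[OF hol open_ball connected_ball _ _ \<beta>(1) f(2), of a] centre_in_ball[of a e] e(1) by blast
  show ?thesis
  proof (rule that[of f U r])
    show "holomorphic_fun_on f U" "b + a *s v \<in> U"
      using U f by auto
    show "f z = 0" if "z \<in> X \<inter> U" for z
      using U f that by auto
    show "b + w *s v \<in> U" if "w \<in> ball a r" for w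
      using that r e by blast
  qed (use r in auto)
qed

lemma finite_fibre: "finite (fibre b)"
proof (rule ccontr)
  assume "infinite (fibre b)"
  moreover have "bounded (fibre b)"
    unfolding bounded_iff fibre_def using fibre_bound[of b] by auto
  then have "compact (fibre b)"
    using closed_fibre compact_eq_bounded_closed by blast
  ultimately obtain a where a: "a \<in> fibre b" "a islimpt fibre b"
    using Heine_Borel_imp_Bolzano_Weierstrass[of "fibre b" "fibre b"] by blast
  obtain f U r where "holomorphic_fun_on f U" "b + a *s v \<in> U"
    and f: "\<And>z. z \<in> X \<inter> U \<Longrightarrow> f z = 0" "r > 0" "\<And>w. w \<in> ball a r \<Longrightarrow> b + w *s v \<in> U"
    "\<And>w. w \<in> ball a r - {a} \<Longrightarrow> f (b + w *s v) \<noteq> 0"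
    by (rule fibre_isolating_function[OF a(1)]) blast
  obtain w where w: "w \<in> fibre b" "w \<in> ball a r" "w \<noteq> a"
    by (rule islimptE[OF a(2), of "ball a r"]) (use f(2) in auto)
  then have "f (b + w *s v) = 0"
    using f(1,3) by (simp add: fibre_def)
  with w f(4) show False
    by blast
qed

text \<open>At a regular point the hypersurface is the zero set of one coordinate of the chart, and the
  number of zeros of that function on vertical discs is locally constant.\<close>

lemma projection_open_at_regular_point:
  assumes "regular_point (CARD('n) - 1) X q" "\<epsilon> > 0"
  obtains \<delta> where "\<delta> > 0" "\<And>y. y \<in> ball q \<delta> \<Longrightarrow> \<exists>s. norm s < \<epsilon> \<and> y + s *s v \<in> X"
proof -
  obtain U V \<phi> \<psi> and I :: "'n set" where q: "q \<in> X" "open U" "q \<in> U" and hom: "homeomorphism U V \<phi> \<psi>"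
    and \<phi>: "holomorphic_map_on \<phi> U" and I: "card I = CARD('n) - 1"
    and im: "\<phi> ` (X \<inter> U) = {w \<in> V. \<forall>i. i \<notin> I \<longrightarrow> w $ i = 0}"
    using assms(1) unfolding regular_point_def by blast
  have "card (- I) = 1"
    using I card_Diff_subset[of I UNIV] zero_less_card_finite[where 'a = 'n] by (simp add: Compl_eq_Diff_UNIV)
  then obtain i where i: "- I = {i}"
    using card_1_singletonE by blast
  define h where "h z = \<phi> z $ i" for z
  have h: "line_holomorphic_on h U"
    using \<phi> holomorphic_imp_line_holomorphic unfolding holomorphic_map_on_def h_def by blast
  have X_iff: "z \<in> X \<longleftrightarrow> h z = 0" if "z \<in> U" for z
  proof
    assume "z \<in> X"
    then have "\<phi> z \<in> \<phi> ` (X \<inter> U)"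
      using that by blast
    then show "h z = 0"
      using im i by (auto simp: h_def)
  next
    assume "h z = 0"
    moreover have "\<phi> z \<in> V"
      using homeomorphism_image1[OF hom] that by blast
    moreover have "j = i" if "j \<notin> I" for j
      using i that by blast
    ultimately have "\<phi> z \<in> \<phi> ` (X \<inter> U)"
      unfolding im h_def by auto
    then obtain x where x: "x \<in> X" "x \<in> U" "\<phi> z = \<phi> x"
      by blast
    have "z = \<psi> (\<phi> z)" "\<psi> (\<phi> x) = x"
      using homeomorphism_apply1[OF hom] that x(2) by simp_all
    with x show "z \<in> X"
      by (simp only: x(3))
  qed
  have "open {w. q + w *s v \<in> U}" "0 \<in> {w. q + w *s v \<in> U}"
    using q by (auto intro: open_line_vimage)
  then obtain e where e: "e > 0" "ball 0 e \<subseteq> {w. q + w *s v \<in> U}"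
    using open_contains_ball by meson
  have "\<not> ball 0 e \<subseteq> fibre q"
    using interior_fibre[of q] e(1) interior_maximal[of "ball 0 e" "fibre q"] by auto
  then obtain \<beta> where \<beta>: "\<beta> \<in> ball 0 e" "q + \<beta> *s v \<notin> X"
    unfolding fibre_def by blast
  then have \<beta>': "h (q + \<beta> *s v) \<noteq> 0"
    using X_iff e by blast
  have hol: "(\<lambda>w. h (q + w *s v)) holomorphic_on ball 0 e"
    by (rule holomorphic_on_subset[OF line_holomorphic_onD(3)[OF h] e(2)])
  have h0: "h (q + 0 *s v) = 0"
    using X_iff q by simp
  obtain r where r: "r > 0" "ball (0 :: complex) r \<subseteq> ball 0 e" "\<And>w. w \<in> ball 0 r - {0} \<Longrightarrow> h (q + w *s v) \<noteq> 0"
    using isolated_zeros[OF hol open_ball connected_ball _ h0 \<beta>(1) \<beta>'] centre_in_ball[of "0 :: complex" e] e(1) by blast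
  \<comment> \<open>Below \<open>r\<close> the circle is free of zeros of \<open>h\<close>; below
    \<open>\<epsilon>\<close> the zeros found in the disc are as small as required.\<close>
  define \<rho> where "\<rho> = min r \<epsilon> / 2"
  have \<rho>: "\<rho> > 0" "\<rho> < r" "\<rho> < \<epsilon>"
    using r(1) assms(2) by (auto simp: \<rho>_def min_def)
  obtain \<delta> where \<delta>: "\<delta> > 0" "zeros_in_disc h U (ball q \<delta>) v 0 \<rho>"
  proof (rule zeros_in_disc_ball[OF h \<rho>(1)])
    show "q + w *s v \<in> U" if "w \<in> cball 0 \<rho>" for w
    proof -
      have "w \<in> ball 0 r"
        using that \<rho> by auto
      then show ?thesis
        using r(2) e(2) by blast
    qed
    show "h (q + w *s v) \<noteq> 0" if "w \<in> sphere 0 \<rho>" for w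
      using that \<rho> by (intro r(3)) auto
  qed
  interpret zeros_in_disc h U "ball q \<delta>" v 0 \<rho>
    by (rule \<delta>)
  show ?thesis
  proof (rule that[OF \<delta>(1)])
    fix y assume y: "y \<in> ball q \<delta>"
    have "0 \<in> zeros q"
      using h0 \<rho> by (simp add: zeros_def)
    then have "zeros y \<noteq> {}"
      using zeros_nonempty[of q y] y \<delta>(1) by auto
    then obtain s where s: "s \<in> ball 0 \<rho>" "h (y + s *s v) = 0"
      by (auto simp: zeros_def)
    then have "y + s *s v \<in> U"
      using y by (intro disc_in_U) auto
    with s X_iff have "y + s *s v \<in> X"
      by blast
    with s \<rho> show "\<exists>s. norm s < \<epsilon> \<and> y + s *s v \<in> X"
      by (intro exI[of _ s]) auto
  qed
qed

end

section \<open>Sheets of the hypersurface over a disc\<close>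

text \<open>Only one inclusion is assumed: \<open>f\<close> vanishes on \<open>X\<close> but may
  have further zeros in the disc, so \<open>disc_fibre\<close> is in general a proper part of
  \<open>zeros\<close>.\<close>

locale hypersurface_in_disc = bounded_fibre_hypersurface X v C + zeros_in_disc f U D v a \<rho>
  for X :: "(complex ^ 'n) set" and v C f U D a \<rho> +
  assumes vanishes: "\<And>z. z \<in> X \<inter> U \<Longrightarrow> f z = 0"
begin

definition disc_fibre :: "complex ^ 'n \<Rightarrow> complex set" where
  "disc_fibre z = fibre z \<inter> ball a \<rho>"

lemma disc_fibre_subset_zeros:
  assumes "z \<in> D"
  shows "disc_fibre z \<subseteq> zeros z"
proof
  fix w assume w: "w \<in> disc_fibre z"
  then have "z + w *s v \<in> X \<inter> U"
    using disc_in_U[OF assms, of w] by (auto simp: disc_fibre_def fibre_def)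
  then show "w \<in> zeros z"
    using vanishes w by (auto simp: zeros_def disc_fibre_def)
qed

text \<open>The set of points over which a sheet lies in the hypersurface is closed and, since it is
  analytic and the closure of its interior, also open.\<close>

lemma sheet_all_or_nothing:
  assumes r: "r > 0" "\<epsilon> > 0" "ball z0 r \<subseteq> D"
    and \<alpha>: "line_holomorphic_on \<alpha> (ball z0 r)" "\<And>z. z \<in> ball z0 r \<Longrightarrow> zeros z \<inter> ball w \<epsilon> = {\<alpha> z}"
    and z: "z \<in> ball z0 r" "\<alpha> z \<in> fibre z" and z': "z' \<in> ball z0 r"
  shows "\<alpha> z' \<in> fibre z'"
proof -
  define B where "B = ball z0 r"
  define T where "T = {z\<in>B. z + \<alpha> z *s v \<in> X}"
  have B: "open B" "connected B"
    by (auto simp: B_def)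
  have \<alpha>_cont: "continuous_on B \<alpha>"
    using line_holomorphic_onD(2)[OF \<alpha>(1)] by (simp add: B_def)
  have graph_cont: "continuous_on B (\<lambda>z. z + \<alpha> z *s v)"
    by (intro continuous_intros \<alpha>_cont)
  have "closedin (top_of_set B) T"
    using continuous_closedin_preimage[OF graph_cont closed_X] by (simp add: T_def vimage_def Int_def)
  moreover have "openin (top_of_set B) T"
  proof -
    have "\<exists>e>0. ball x e \<subseteq> T" if x: "x \<in> T" for x
    proof -
      have xB: "x \<in> B" and xX: "x + \<alpha> x *s v \<in> X"
        using x by (auto simp: T_def)
      define p where "p = x + \<alpha> x *s v"
      obtain W F where W: "open W" "p \<in> W" "\<forall>f\<in>F. holomorphic_fun_on f W"
        "X \<inter> W = {z \<in> W. \<forall>f\<in>F. f z = 0}"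
        using analytic_X[unfolded analytic_subset_def, rule_format, of p] by blast
      have "open (B \<inter> (\<lambda>z. z + \<alpha> z *s v) -` W)"
        by (rule continuous_open_preimage[OF graph_cont B(1) W(1)])
      moreover have "x \<in> B \<inter> (\<lambda>z. z + \<alpha> z *s v) -` W"
        using xB W by (simp add: p_def)
      ultimately obtain e where e: "e > 0" "ball x e \<subseteq> B \<inter> (\<lambda>z. z + \<alpha> z *s v) -` W"
        using open_contains_ball by blast
      have \<alpha>x: "\<alpha> x \<in> zeros x" "\<alpha> x \<in> ball w \<epsilon>"
        using \<alpha>(2)[of x] xB unfolding B_def by blast+
      then have "\<alpha> x \<in> ball w \<epsilon> \<inter> ball a \<rho>"
        by (auto simp: zeros_def)
      then obtain \<eta> where \<eta>: "\<eta> > 0" "ball (\<alpha> x) \<eta> \<subseteq> ball w \<epsilon> \<inter> ball a \<rho>"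
        by (meson open_Int open_ball open_contains_ball)
      \<comment> \<open>A point of \<open>X\<close> with parameter near \<open>\<alpha> x\<close> is
        a zero of \<open>f\<close> in \<open>ball w \<epsilon>\<close>, and the sheet is the only
        such zero.\<close>
      have uniq: "\<alpha> y = s" if "y \<in> B" "s \<in> ball (\<alpha> x) \<eta>" "y + s *s v \<in> X" for y s
      proof -
        have "s \<in> disc_fibre y"
          using that \<eta> by (auto simp: disc_fibre_def fibre_def)
        then have "s \<in> zeros y"
          using disc_fibre_subset_zeros r(3) that(1) unfolding B_def by blast
        then have "s \<in> zeros y \<inter> ball w \<epsilon>"
          using that \<eta> by blast
        moreover have "zeros y \<inter> ball w \<epsilon> = {\<alpha> y}"
          using \<alpha>(2) that(1) by (simp add: B_def)
        ultimately show ?thesis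
          by (metis singletonD)
      qed
      have "open (ball p e)" "p \<in> ball p e"
        using e by auto
      then obtain q where q: "q \<in> ball p e" "regular_point (CARD('n) - 1) X q"
        using regular_dense[OF xX] unfolding regular_dims_near_def p_def by blast
      obtain \<delta> where \<delta>: "\<delta> > 0" "\<And>y. y \<in> ball q \<delta> \<Longrightarrow> \<exists>s. norm s < \<eta> \<and> y + s *s v \<in> X"
        using projection_open_at_regular_point[OF q(2) \<eta>(1)] by blast
      \<comment> \<open>The regular point \<open>q\<close> need not lie over \<open>x\<close>.
        Writing it as \<open>y0 + \<alpha> x *s v\<close> puts its base point in
        \<open>ball x e\<close>; the lines over base points near \<open>y0\<close> then meet
        \<open>X\<close> at parameters near \<open>\<alpha> x\<close>, so on the sheet.\<close>
      define y0 where "y0 = q - \<alpha> x *s v"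
      have y0: "y0 \<in> ball x e"
        using q(1) by (simp add: y0_def p_def dist_norm algebra_simps)
      define V where "V = ball y0 \<delta> \<inter> ball x e"
      have VT: "V \<subseteq> T"
      proof
        fix y assume y: "y \<in> V"
        then have "y + \<alpha> x *s v \<in> ball q \<delta>"
          by (simp add: V_def y0_def dist_norm algebra_simps)
        then obtain s where s: "norm s < \<eta>" "y + \<alpha> x *s v + s *s v \<in> X"
          using \<delta>(2) by blast
        then have "y + (\<alpha> x + s) *s v \<in> X"
          by (simp add: vector_sadd_rdistrib add.assoc)
        moreover have "y \<in> B"
          using y e by (auto simp: V_def)
        moreover have "\<alpha> x + s \<in> ball (\<alpha> x) \<eta>"
          using s by (simp add: dist_norm)
        ultimately show "y \<in> T"
          using uniq[of y "\<alpha> x + s"] by (simp add: T_def)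
      qed
      \<comment> \<open>Restricted to the sheet, every local equation of \<open>X\<close> vanishes
        on the open set \<open>V\<close>, hence on the whole ball.\<close>
      have "ball x e \<subseteq> T"
      proof
        fix y assume y: "y \<in> ball x e"
        have "g (y + \<alpha> y *s v) = 0" if g: "g \<in> F" for g
        proof (rule line_holomorphic_identity[of "\<lambda>z. g (z + \<alpha> z *s v)" "ball x e" V y0])
          show "line_holomorphic_on (\<lambda>z. g (z + \<alpha> z *s v)) (ball x e)"
          proof (rule line_holomorphic_on_compose_graph)
            show "holomorphic_fun_on g W"
              using W g by blast
            show "line_holomorphic_on \<alpha> (ball x e)"
              by (rule line_holomorphic_on_subset[OF \<alpha>(1)]) (use e in \<open>auto simp: B_def\<close>)
          qed (use e in auto)
          show "g (z + \<alpha> z *s v) = 0" if "z \<in> V" for z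
          proof -
            have "z + \<alpha> z *s v \<in> X \<inter> W"
              using that VT e unfolding T_def V_def by blast
            then show ?thesis
              using W(4) g by blast
          qed
        qed (use y y0 \<delta> in \<open>auto simp: V_def\<close>)
        moreover have "y \<in> B" "y + \<alpha> y *s v \<in> W"
          using y e by auto
        ultimately show "y \<in> T"
          using W(4) unfolding T_def by blast
      qed
      with e show ?thesis by blast
    qed
    then have "open T"
      using open_contains_ball by blast
    then show ?thesis
      by (simp add: openin_open_eq B T_def)
  qed
  ultimately have "T = {} \<or> T = B"
    using B(2) connected_clopen by blast
  moreover have "z \<in> T"
    using z by (simp add: T_def B_def fibre_def)
  ultimately have "z' \<in> T"
    using z' unfolding B_def by blast
  then show ?thesis
    by (simp add: T_def fibre_def)
qed

text \<open>Each sheet lies in \<open>X\<close> over the whole ball or nowhere, so the disc fibre is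
  described by one fixed set \<open>S\<close> of sheets; its cardinality is constant and its product
  is a product of holomorphic root functions.\<close>

lemma disc_fibre_locally:
  assumes z0: "z0 \<in> D" and max: "\<And>z. z \<in> D \<Longrightarrow> card (zeros z) \<le> card (zeros z0)"
  obtains r where "r > 0" "ball z0 r \<subseteq> D"
    "\<And>z. z \<in> ball z0 r \<Longrightarrow> card (disc_fibre z) = card (disc_fibre z0)"
    "line_holomorphic_on (\<lambda>z. \<Prod>w\<in>disc_fibre z. w) (ball z0 r)"
proof -
  obtain r \<epsilon> \<alpha> where r: "r > 0" "\<epsilon> > 0" "ball z0 r \<subseteq> D"
    and hol: "\<And>w. w \<in> zeros z0 \<Longrightarrow> line_holomorphic_on (\<alpha> w) (ball z0 r)"
    and uniq: "\<And>w z. w \<in> zeros z0 \<Longrightarrow> z \<in> ball z0 r \<Longrightarrow> zeros z \<inter> ball w \<epsilon> = {\<alpha> w z}"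
    and eq: "\<And>z. z \<in> ball z0 r \<Longrightarrow> zeros z = (\<lambda>w. \<alpha> w z) ` zeros z0"
    and inj: "\<And>z. z \<in> ball z0 r \<Longrightarrow> inj_on (\<lambda>w. \<alpha> w z) (zeros z0)"
    by (rule local_root_functions[OF z0 max]) blast+
  define S where "S = {w\<in>zeros z0. \<alpha> w z0 \<in> fibre z0}"
  have z0_in: "z0 \<in> ball z0 r"
    using r by simp
  have S: "\<alpha> w z \<in> fibre z \<longleftrightarrow> w \<in> S" if "w \<in> zeros z0" "z \<in> ball z0 r" for w z
  proof
    assume "\<alpha> w z \<in> fibre z"
    then have "\<alpha> w z0 \<in> fibre z0"
      using sheet_all_or_nothing[OF r hol[OF that(1)] uniq[OF that(1)] that(2) _ z0_in] by blast
    then show "w \<in> S"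
      using that by (simp add: S_def)
  next
    assume "w \<in> S"
    then have "\<alpha> w z0 \<in> fibre z0"
      by (simp add: S_def)
    then show "\<alpha> w z \<in> fibre z"
      using sheet_all_or_nothing[OF r hol[OF that(1)] uniq[OF that(1)] z0_in _ that(2)] by blast
  qed
  have im: "disc_fibre z = (\<lambda>w. \<alpha> w z) ` S" if z: "z \<in> ball z0 r" for z
  proof -
    have "disc_fibre z = {w\<in>zeros z. w \<in> fibre z}"
    proof -
      have "z \<in> D"
        using r z by blast
      from disc_fibre_subset_zeros[OF this] show ?thesis
        unfolding disc_fibre_def zeros_def by blast
    qed
    also have "\<dots> = (\<lambda>w. \<alpha> w z) ` S"
      using S[OF _ z] unfolding eq[OF z] by (auto simp: S_def)
    finally show ?thesis .
  qed
  have injS: "inj_on (\<lambda>w. \<alpha> w z) S" if "z \<in> ball z0 r" for z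
    by (rule inj_on_subset[OF inj[OF that]]) (auto simp: S_def)
  show ?thesis
  proof (rule that[OF r(1,3)])
    show "card (disc_fibre z) = card (disc_fibre z0)" if "z \<in> ball z0 r" for z
      using im[OF that] im[OF z0_in] injS[OF that] injS[OF z0_in] by (simp add: card_image)
    have "line_holomorphic_on (\<lambda>z. \<Prod>w\<in>S. \<alpha> w z) (ball z0 r)"
      by (intro line_holomorphic_on_prod hol) (auto simp: S_def)
    then show "line_holomorphic_on (\<lambda>z. \<Prod>w\<in>disc_fibre z. w) (ball z0 r)"
      by (rule line_holomorphic_on_cong) (simp add: im injS prod.reindex)
  qed
qed

end

text \<open>The complement of the zero set of the discriminant is connected, so the locally constant
  number of points is constant there. The product is bounded because its factors stay in a disc,
  which is what Riemann's theorem needs.\<close>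

lemma (in hypersurface_in_disc) disc_fibre_extension:
  assumes D: "D = ball b R" and "R > 0"
  obtains r H N g where "0 < r" "line_holomorphic_on H (ball b r)" "\<exists>p\<in>ball b r. H p \<noteq> 0"
    "line_holomorphic_on g (ball b r)"
    "\<And>z. z \<in> ball b r \<Longrightarrow> H z \<noteq> 0 \<Longrightarrow> card (fibre z \<inter> ball a \<rho>) = N \<and> g z = (\<Prod>w\<in>fibre z \<inter> ball a \<rho>. w)"
proof -
  obtain m p where p: "p \<in> D" "discriminant m p \<noteq> 0"
    and le: "\<And>z. z \<in> D \<Longrightarrow> card (zeros z) \<le> m"
    and iff: "\<And>z. z \<in> D \<Longrightarrow> discriminant m z \<noteq> 0 \<longleftrightarrow> card (zeros z) = m"
    by (rule generic_number_of_zeros) (use D \<open>R > 0\<close> in auto)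
  define H where "H = discriminant m"
  have H: "line_holomorphic_on H (ball b R)"
    using line_holomorphic_discriminant D by (simp add: H_def)
  define G where "G = {z\<in>ball b R. H z \<noteq> 0}"
  have GD: "z \<in> D" "card (zeros z) = m" if "z \<in> G" for z
    using that iff by (auto simp: G_def D H_def)
  have openG: "open G"
    unfolding G_def by (rule line_holomorphic_open_nonzero[OF H])
  have loc: "\<exists>r>0. (\<forall>z\<in>ball z0 r. card (disc_fibre z) = card (disc_fibre z0)) \<and>
      line_holomorphic_on (\<lambda>z. \<Prod>w\<in>disc_fibre z. w) (ball z0 r)" if z0: "z0 \<in> G" for z0
  proof -
    have max: "card (zeros z) \<le> card (zeros z0)" if "z \<in> D" for z
      using le[OF that] GD(2)[OF z0] by simp
    obtain r where "r > 0" "ball z0 r \<subseteq> D"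
      "\<And>z. z \<in> ball z0 r \<Longrightarrow> card (disc_fibre z) = card (disc_fibre z0)"
      "line_holomorphic_on (\<lambda>z. \<Prod>w\<in>disc_fibre z. w) (ball z0 r)"
      by (rule disc_fibre_locally[OF GD(1)[OF z0] max]) blast+
    then show ?thesis by blast
  qed
  have const: "card (disc_fibre x) = card (disc_fibre y)" if "x \<in> G" "y \<in> G" for x y
  proof (rule connected_local_const[of G])
    show "connected G"
      unfolding G_def by (rule line_holomorphic_connected_nonzero[OF H]) simp
    show "\<forall>x\<in>G. \<forall>\<^sub>F y in at x within G. card (disc_fibre x) = card (disc_fibre y)"
    proof
      fix x assume "x \<in> G"
      from loc[OF this] obtain r where r: "r > 0" "\<forall>z\<in>ball x r. card (disc_fibre z) = card (disc_fibre x)"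
        by (elim exE conjE)
      have "card (disc_fibre x) = card (disc_fibre y)" if "dist y x < r" for y
      proof -
        have "y \<in> ball x r"
          using that by (simp add: dist_commute)
        with r(2) show ?thesis by simp
      qed
      with r(1) show "\<forall>\<^sub>F y in at x within G. card (disc_fibre x) = card (disc_fibre y)"
        unfolding eventually_at by blast
    qed
  qed (use that in auto)
  have hol: "line_holomorphic_on (\<lambda>z. \<Prod>w\<in>disc_fibre z. w) G"
  proof (rule line_holomorphic_on_local[OF openG])
    fix z assume "z \<in> G"
    from loc[OF this] obtain r where "r > 0" "line_holomorphic_on (\<lambda>z. \<Prod>w\<in>disc_fibre z. w) (ball z r)"
      by blast
    then show "\<exists>V. z \<in> V \<and> line_holomorphic_on (\<lambda>z. \<Prod>w\<in>disc_fibre z. w) V"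
      by (intro exI[of _ "ball z r"]) auto
  qed
  \<comment> \<open>The lower bound \<open>1\<close> makes powers of \<open>K\<close> increase with
    the exponent, so the varying cardinality can be replaced by \<open>m\<close>.\<close>
  define K where "K = max 1 (norm a + \<rho>)"
  have bdd: "norm (\<Prod>w\<in>disc_fibre z. w) \<le> K ^ m" if z: "z \<in> G" for z
  proof -
    have "norm (\<Prod>w\<in>disc_fibre z. w) \<le> (\<Prod>w\<in>disc_fibre z. K)"
      unfolding prod_norm[symmetric]
    proof (rule prod_mono)
      fix w assume "w \<in> disc_fibre z"
      then have "norm (w - a) < \<rho>"
        by (simp add: disc_fibre_def dist_norm norm_minus_commute)
      then show "0 \<le> norm w \<and> norm w \<le> K"
        using norm_triangle_ineq2[of w a] by (auto simp: K_def)
    qed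
    also have "\<dots> = K ^ card (disc_fibre z)"
      by simp
    also have "\<dots> \<le> K ^ m"
    proof (rule power_increasing)
      show "card (disc_fibre z) \<le> m"
        using card_mono[OF finite_zeros disc_fibre_subset_zeros] GD[OF z] by fastforce
    qed (simp add: K_def)
    finally show ?thesis .
  qed
  obtain r g where r: "0 < r" "r \<le> R" "line_holomorphic_on g (ball b r)"
    "\<And>z. z \<in> ball b r \<Longrightarrow> H z \<noteq> 0 \<Longrightarrow> g z = (\<Prod>w\<in>disc_fibre z. w)"
  proof (rule line_holomorphic_Riemann_extension[OF H])
    show "p \<in> ball b R" "H p \<noteq> 0"
      using p by (auto simp: D H_def)
    show "line_holomorphic_on (\<lambda>z. \<Prod>w\<in>disc_fibre z. w) {z\<in>ball b R. H z \<noteq> 0}"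
      using hol by (simp add: G_def)
    show "norm (\<Prod>w\<in>disc_fibre z. w) \<le> K ^ m" if "z \<in> ball b R" "H z \<noteq> 0" for z
      using that by (intro bdd) (simp add: G_def)
  qed blast
  have "p \<in> G"
    using p by (simp add: G_def H_def D)
  show ?thesis
  proof (rule that[OF r(1) _ _ r(3)])
    show "line_holomorphic_on H (ball b r)"
      by (rule line_holomorphic_on_subset[OF H]) (use r in auto)
    \<comment> \<open>The known point \<open>p\<close> may lie outside the smaller ball; the
      identity theorem prevents \<open>H\<close> from vanishing throughout it.\<close>
    show "\<exists>p\<in>ball b r. H p \<noteq> 0"
    proof (rule ccontr)
      assume *: "\<not> (\<exists>p\<in>ball b r. H p \<noteq> 0)"
      have "H p = 0"
        by (rule line_holomorphic_identity[OF H convex_ball, of "ball b r" b]) (use * r p D in auto)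
      with p show False by (simp add: H_def)
    qed
    fix z assume z: "z \<in> ball b r" "H z \<noteq> 0"
    then have "z \<in> G"
      using r by (auto simp: G_def)
    then show "card (fibre z \<inter> ball a \<rho>) = card (disc_fibre p) \<and> g z = (\<Prod>w\<in>fibre z \<inter> ball a \<rho>. w)"
      using const[OF _ \<open>p \<in> G\<close>] r(4)[OF z] by (simp add: disc_fibre_def)
  qed
qed

text \<open>Holomorphic functions on a convex open set have no zero divisors: by the identity
  theorem the next factor cannot vanish on the open set where the previous product is
  nonzero.\<close>

lemma line_holomorphic_prod_nonzero:
  assumes "finite A" "convex B" "B \<noteq> {}" "\<And>a. a \<in> A \<Longrightarrow> line_holomorphic_on (H a) B"
    "\<And>a. a \<in> A \<Longrightarrow> \<exists>p\<in>B. H a p \<noteq> 0" "open B"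
  shows "\<exists>p\<in>B. (\<Prod>a\<in>A. H a p) \<noteq> 0"
  using assms
proof (induction A rule: finite_induct)
  case (insert x A)
  let ?V = "{z\<in>B. (\<Prod>a\<in>A. H a z) \<noteq> 0}"
  have "line_holomorphic_on (\<lambda>z. \<Prod>a\<in>A. H a z) B"
    using insert.prems by (intro line_holomorphic_on_prod) auto
  then have "open ?V"
    by (rule line_holomorphic_open_nonzero)
  obtain p where p: "p \<in> ?V"
    using insert by auto
  have "\<exists>z\<in>?V. H x z \<noteq> 0"
  proof (rule ccontr)
    assume "\<not> (\<exists>z\<in>?V. H x z \<noteq> 0)"
    then have "H x z = 0" if "z \<in> B" for z
      using line_holomorphic_identity[OF _ \<open>convex B\<close> \<open>open ?V\<close> _ p _ that, of "H x"] insert.prems by auto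
    with insert.prems show False by blast
  qed
  then show ?case
    using insert.hyps by auto
qed auto

section \<open>Local and global defining functions\<close>

context bounded_fibre_hypersurface
begin

text \<open>The fibre over \<open>b\<close> is enclosed in disjoint discs, one for each of its
  points. Boundedness and compactness keep all nearby fibres inside these discs, so cardinalities
  add and products multiply over the discs.\<close>

lemma local_defining_function:
  obtains r H N g where "r > 0" "line_holomorphic_on H (ball b r)" "\<exists>p\<in>ball b r. H p \<noteq> 0"
    "line_holomorphic_on g (ball b r)"
    "\<And>z. z \<in> ball b r \<Longrightarrow> H z \<noteq> 0 \<Longrightarrow> card (fibre z) = N \<and> g z = (\<Prod>w\<in>fibre z. w)"
proof -
  define A where "A = fibre b"
  have "finite A"
    unfolding A_def by (rule finite_fibre)
  \<comment> \<open>All discs are to have the same radius, so the data for one point are packed into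
    a predicate that holds for all small radii.\<close>
  define isolated where "isolated a \<epsilon> \<longleftrightarrow> (\<forall>a'\<in>A. a \<noteq> a' \<longrightarrow> cball a \<epsilon> \<inter> cball a' \<epsilon> = {}) \<and>
    (\<exists>f U. line_holomorphic_on f U \<and> (\<forall>z\<in>X \<inter> U. f z = 0) \<and>
      (\<forall>w\<in>cball a \<epsilon>. b + w *s v \<in> U) \<and> (\<forall>w\<in>sphere a \<epsilon>. f (b + w *s v) \<noteq> 0))" for a \<epsilon>
  obtain \<rho> where \<rho>: "\<rho> > 0" "\<And>a. a \<in> A \<Longrightarrow> isolated a \<rho>"
  proof (rule finite_uniform_radius[OF \<open>finite A\<close>])
    fix a assume a: "a \<in> A"
    obtain f U r where f: "holomorphic_fun_on f U" "b + a *s v \<in> U" "\<And>z. z \<in> X \<inter> U \<Longrightarrow> f z = 0"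
      "r > 0" "\<And>w. w \<in> ball a r \<Longrightarrow> b + w *s v \<in> U" "\<And>w. w \<in> ball a r - {a} \<Longrightarrow> f (b + w *s v) \<noteq> 0"
      by (rule fibre_isolating_function[of a b]) (use a A_def in blast)+
    obtain e where e: "e > 0" "\<forall>\<epsilon>. 0 < \<epsilon> \<and> \<epsilon> \<le> e \<longrightarrow> cball a \<epsilon> \<subseteq> UNIV \<and>
        (\<forall>w'\<in>A. a \<noteq> w' \<longrightarrow> cball a \<epsilon> \<inter> cball w' \<epsilon> = {})"
      using finite_separating_radius[OF \<open>finite A\<close> a, of UNIV] by auto
    have "isolated a \<epsilon>" if \<epsilon>: "0 < \<epsilon>" "\<epsilon> \<le> min e (r/2)" for \<epsilon>
      unfolding isolated_def
    proof (intro conjI exI[of _ f] exI[of _ U])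
      show "\<forall>w'\<in>A. a \<noteq> w' \<longrightarrow> cball a \<epsilon> \<inter> cball w' \<epsilon> = {}"
        using e \<epsilon> by simp
      show "line_holomorphic_on f U" "\<forall>z\<in>X \<inter> U. f z = 0"
        using f holomorphic_imp_line_holomorphic by auto
      show "\<forall>w\<in>cball a \<epsilon>. b + w *s v \<in> U"
        using f(4,5) \<epsilon> by auto
      show "\<forall>w\<in>sphere a \<epsilon>. f (b + w *s v) \<noteq> 0"
      proof
        fix w assume w: "w \<in> sphere a \<epsilon>"
        then have "w \<in> ball a r - {a}"
          using \<epsilon> f(4) by auto
        then show "f (b + w *s v) \<noteq> 0"
          by (rule f(6))
      qed
    qed
    then show "\<exists>e>0. \<forall>\<epsilon>. 0 < \<epsilon> \<and> \<epsilon> \<le> e \<longrightarrow> isolated a \<epsilon>"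
      using e f(4) by (intro exI[of _ "min e (r/2)"]) auto
  qed auto
  \<comment> \<open>The same device for the radius in the base: the extensions restrict to smaller
    balls, so one ball can serve all points of \<open>A\<close>.\<close>
  define spec where "spec a r H N g \<longleftrightarrow> line_holomorphic_on H (ball b r) \<and> (\<exists>p\<in>ball b r. H p \<noteq> 0) \<and>
    line_holomorphic_on g (ball b r) \<and> (\<forall>z\<in>ball b r. H z \<noteq> 0 \<longrightarrow>
      card (fibre z \<inter> ball a \<rho>) = N \<and> g z = (\<Prod>w\<in>fibre z \<inter> ball a \<rho>. w))" for a r H N g
  obtain r1 where r1: "r1 > 0" "\<And>a r. a \<in> A \<Longrightarrow> 0 < r \<Longrightarrow> r \<le> r1 \<Longrightarrow> \<exists>H N g. spec a r H N g"
  proof (rule finite_uniform_radius[OF \<open>finite A\<close>])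
    fix a assume "a \<in> A"
    then have "isolated a \<rho>"
      by (rule \<rho>)
    then obtain f U where f: "line_holomorphic_on f U" "\<And>z. z \<in> X \<inter> U \<Longrightarrow> f z = 0"
      "\<And>w. w \<in> cball a \<rho> \<Longrightarrow> b + w *s v \<in> U" "\<And>w. w \<in> sphere a \<rho> \<Longrightarrow> f (b + w *s v) \<noteq> 0"
      unfolding isolated_def by blast
    obtain R where R: "R > 0" "zeros_in_disc f U (ball b R) v a \<rho>"
      by (rule zeros_in_disc_ball[OF f(1) \<rho>(1) f(3,4)]) blast+
    then interpret hypersurface_in_disc X v C f U "ball b R" a \<rho>
      using f(2) bounded_fibre_hypersurface_axioms
      by (intro hypersurface_in_disc.intro hypersurface_in_disc_axioms.intro) auto
    obtain r H N g where r: "0 < r" and H: "line_holomorphic_on H (ball b r)" "\<exists>p\<in>ball b r. H p \<noteq> 0"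
      and g: "line_holomorphic_on g (ball b r)"
      "\<And>z. z \<in> ball b r \<Longrightarrow> H z \<noteq> 0 \<Longrightarrow> card (fibre z \<inter> ball a \<rho>) = N \<and> g z = (\<Prod>w\<in>fibre z \<inter> ball a \<rho>. w)"
      by (rule disc_fibre_extension[OF refl R(1)]) blast
    have "spec a s H N g" if s: "0 < s" "s \<le> r" for s
      unfolding spec_def
    proof (intro conjI ballI impI)
      show "line_holomorphic_on H (ball b s)" "line_holomorphic_on g (ball b s)"
        using s by (auto intro: line_holomorphic_on_subset[OF H(1)] line_holomorphic_on_subset[OF g(1)])
      show "\<exists>p\<in>ball b s. H p \<noteq> 0"
      proof (rule ccontr)
        assume *: "\<not> (\<exists>p\<in>ball b s. H p \<noteq> 0)"
        have "H p = 0" if "p \<in> ball b r" for p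
          by (rule line_holomorphic_identity[OF H(1) convex_ball, of "ball b s" b]) (use * s that in auto)
        with H(2) show False by blast
      qed
    qed (use g(2) s in auto)
    then show "\<exists>e>0. \<forall>r. 0 < r \<and> r \<le> e \<longrightarrow> (\<exists>H N g. spec a r H N g)"
      using r by blast
  qed auto
  \<comment> \<open>Bounds all fibre parameters over base points within distance \<open>1\<close> of
    \<open>b\<close>, where \<open>1 + norm z \<le> 2 + norm b\<close>; the sign of \<open>C\<close>
    is left open, hence the absolute value.\<close>
  define M where "M = \<bar>C\<bar> * (2 + norm b)"
  have cpt: "compact (cball 0 M - (\<Union>a\<in>A. ball a \<rho>))"
    by (intro compact_diff) auto
  have avoid: "b + w *s v \<in> - X" if "w \<in> cball 0 M - (\<Union>a\<in>A. ball a \<rho>)" for w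
    using that \<rho>(1) by (force simp: A_def fibre_def)
  obtain r2 where r2: "r2 > 0"
    "\<And>z w. z \<in> ball b r2 \<Longrightarrow> w \<in> cball 0 M - (\<Union>a\<in>A. ball a \<rho>) \<Longrightarrow> z + w *s v \<in> - X"
    by (rule line_tube[OF open_Compl[OF closed_X] cpt avoid]) blast+
  define r where "r = Min {r1, r2, 1}"
  have r: "r > 0" "r \<le> r1" "r \<le> r2" "r \<le> 1"
    using r1 r2 by (auto simp: r_def)
  have fibre_eq: "fibre z = (\<Union>a\<in>A. fibre z \<inter> ball a \<rho>)" if z: "z \<in> ball b r" for z
  proof -
    have "w \<in> (\<Union>a\<in>A. ball a \<rho>)" if w: "w \<in> fibre z" for w
    proof (rule ccontr)
      assume n: "w \<notin> (\<Union>a\<in>A. ball a \<rho>)"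
      have "norm z \<le> norm b + 1"
        using z r norm_triangle_ineq2[of z b] by (simp add: dist_norm norm_minus_commute)
      then have "\<bar>C\<bar> * (1 + norm z) \<le> M"
        unfolding M_def by (intro mult_left_mono) auto
      moreover have "norm w \<le> C * (1 + norm z)"
        using w by (intro fibre_bound) (simp add: fibre_def)
      moreover have "C * (1 + norm z) \<le> \<bar>C\<bar> * (1 + norm z)"
        by (intro mult_right_mono) auto
      ultimately have "w \<in> cball 0 M"
        by simp
      then have "z + w *s v \<in> - X"
        using n z r by (intro r2) auto
      with w show False
        by (simp add: fibre_def)
    qed
    then show ?thesis by blast
  qed
  have "\<forall>a\<in>A. \<exists>H N g. spec a r H N g"
    using r1 r by simp
  then obtain H N g where spec: "\<And>a. a \<in> A \<Longrightarrow> spec a r (H a) (N a) (g a)"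
    by metis
  have H: "line_holomorphic_on (H a) (ball b r)" "\<exists>p\<in>ball b r. H a p \<noteq> 0"
    and g: "line_holomorphic_on (g a) (ball b r)"
    "\<And>z. z \<in> ball b r \<Longrightarrow> H a z \<noteq> 0 \<Longrightarrow> card (fibre z \<inter> ball a \<rho>) = N a"
    "\<And>z. z \<in> ball b r \<Longrightarrow> H a z \<noteq> 0 \<Longrightarrow> g a z = (\<Prod>w\<in>fibre z \<inter> ball a \<rho>. w)" if "a \<in> A" for a
    using spec[OF that] unfolding spec_def by auto
  show ?thesis
  proof (rule that[OF r(1), of "\<lambda>z. \<Prod>a\<in>A. H a z" "\<lambda>z. \<Prod>a\<in>A. g a z" "\<Sum>a\<in>A. N a"])
    show "line_holomorphic_on (\<lambda>z. \<Prod>a\<in>A. H a z) (ball b r)" "line_holomorphic_on (\<lambda>z. \<Prod>a\<in>A. g a z) (ball b r)"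
      by (intro line_holomorphic_on_prod H g; simp)+
    show "\<exists>p\<in>ball b r. (\<Prod>a\<in>A. H a p) \<noteq> 0"
      by (rule line_holomorphic_prod_nonzero[OF \<open>finite A\<close>]) (use H r in auto)
    fix z assume z: "z \<in> ball b r" "(\<Prod>a\<in>A. H a z) \<noteq> 0"
    then have nz: "H a z \<noteq> 0" if "a \<in> A" for a
      using that \<open>finite A\<close> by auto
    have disj: "(fibre z \<inter> ball a \<rho>) \<inter> (fibre z \<inter> ball a' \<rho>) = {}" if "a \<in> A" "a' \<in> A" "a \<noteq> a'" for a a'
    proof -
      have "cball a \<rho> \<inter> cball a' \<rho> = {}"
        using \<rho>(2)[OF that(1)] that unfolding isolated_def by blast
      then show ?thesis
        using ball_subset_cball by blast
    qed
    have "card (\<Union>a\<in>A. fibre z \<inter> ball a \<rho>) = (\<Sum>a\<in>A. card (fibre z \<inter> ball a \<rho>))"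
      using \<open>finite A\<close> finite_fibre disj by (intro card_UN_disjoint) auto
    moreover have "(\<Prod>w\<in>(\<Union>a\<in>A. fibre z \<inter> ball a \<rho>). w) = (\<Prod>a\<in>A. \<Prod>w\<in>fibre z \<inter> ball a \<rho>. w)"
      using \<open>finite A\<close> finite_fibre disj by (intro prod.UNION_disjoint) auto
    ultimately show "card (fibre z) = (\<Sum>a\<in>A. N a) \<and> (\<Prod>a\<in>A. g a z) = (\<Prod>w\<in>fibre z. w)"
      using g(2,3)[OF _ z(1) nz] fibre_eq[OF z(1)] by simp
  qed
qed

end

context bounded_fibre_hypersurface
begin

lemma norm_prod_fibre_le: "norm (\<Prod>w\<in>fibre z. w) \<le> (C * (1 + norm z)) ^ card (fibre z)"
proof -
  have "norm (\<Prod>w\<in>fibre z. w) \<le> (\<Prod>w\<in>fibre z. C * (1 + norm z))"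
    unfolding prod_norm[symmetric] by (intro prod_mono) (auto simp: fibre_def intro: fibre_bound)
  then show ?thesis by simp
qed

text \<open>The local extensions agree because each equals the fibre product on a dense open subset
  of its ball, and two such subsets meet wherever the balls overlap. The number of points in a
  generic fibre is locally constant on the whole space, hence constant, and becomes the exponent of
  growth.\<close>

theorem global_defining_function:
  obtains g N where "line_holomorphic_on g UNIV" "\<And>z. norm (g z) \<le> (C * (1 + norm z)) ^ N"
    "X = {z. g z = 0}"
proof -
  have "\<forall>b. \<exists>r H N g. r > 0 \<and> line_holomorphic_on H (ball b r) \<and> (\<exists>p\<in>ball b r. H p \<noteq> 0) \<and>
    line_holomorphic_on g (ball b r) \<and>
    (\<forall>z. z \<in> ball b r \<longrightarrow> H z \<noteq> 0 \<longrightarrow> card (fibre z) = N \<and> g z = (\<Prod>w\<in>fibre z. w))"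
    (is "\<forall>b. ?P b")
  proof
    fix b
    show "?P b"
      by (rule local_defining_function[of b]) blast
  qed
  then obtain rad H N gl where rad: "\<And>b. rad b > 0" and H: "\<And>b. line_holomorphic_on (H b) (ball b (rad b))"
      "\<And>b. \<exists>p\<in>ball b (rad b). H b p \<noteq> 0" and gl: "\<And>b. line_holomorphic_on (gl b) (ball b (rad b))"
    and loc: "\<And>b z. z \<in> ball b (rad b) \<Longrightarrow> H b z \<noteq> 0 \<Longrightarrow> card (fibre z) = N b \<and> gl b z = (\<Prod>w\<in>fibre z. w)"
    by metis
  define B where "B b = ball b (rad b)" for b
  define G where "G b = {z\<in>B b. H b z \<noteq> 0}" for b
  have G: "card (fibre z) = N b" "gl b z = (\<Prod>w\<in>fibre z. w)" if "z \<in> G b" for z b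
    using that loc[of z b] by (auto simp: G_def B_def)
  have center: "b \<in> B b" and openB: "open (B b)" for b
    using rad by (auto simp: B_def)
  have openG: "open (G b)" for b
    unfolding G_def B_def by (rule line_holomorphic_open_nonzero[OF H(1)])
  have meets: "\<exists>y. y \<in> W \<inter> G b" if "open W" "W \<inter> B b \<noteq> {}" for W b
  proof -
    have "B b \<subseteq> closure (G b)"
      unfolding B_def G_def using H line_holomorphic_nonzero_dense by blast
    with that(2) have "W \<inter> closure (G b) \<noteq> {}"
      by blast
    then show ?thesis
      using open_Int_closure_eq_empty[OF that(1), of "G b"] by blast
  qed
  have meets2: "\<exists>y. y \<in> W \<inter> G b \<inter> G c" if W: "open W" "W \<inter> B b \<inter> B c \<noteq> {}" for W b c
  proof -
    obtain y where y: "y \<in> (W \<inter> B c) \<inter> G b"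
      using meets[OF open_Int[OF W(1) openB], of c b] W(2) by blast
    then show ?thesis
      using meets[OF open_Int[OF W(1) openG], of b c] by blast
  qed
  have N_eq: "N b = N c" if "c \<in> B b" for b c
  proof -
    have "c \<in> UNIV \<inter> B b \<inter> B c"
      using that center[of c] by simp
    then obtain y where "y \<in> G b" "y \<in> G c"
      using meets2[OF open_UNIV, of b c] by blast
    then show ?thesis
      using G(1)[of y b] G(1)[of y c] by simp
  qed
  have N: "N b = N c" for b c
  proof (rule connected_local_const[of UNIV b c N])
    show "\<forall>x\<in>UNIV. \<forall>\<^sub>F y in at x within UNIV. N x = N y"
    proof
      fix x
      show "\<forall>\<^sub>F y in at x. N x = N y"
        using eventually_at_in_open'[OF openB center, of x] by eventually_elim (rule N_eq)
    qed
  qed auto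
  define n where "n = N 0"
  have Gn: "card (fibre z) = n" if "z \<in> G b" for z b
    using G(1)[OF that] N[of b 0] by (simp add: n_def)
  \<comment> \<open>The value of the extension centred at \<open>z\<close>, not the product over
    \<open>fibre z\<close>: where sheets meet, that product would lose repeated factors.\<close>
  define g where "g z = gl z z" for z
  have g_eq: "gl b z = g z" if z: "z \<in> B b" for b z
  proof (rule ccontr)
    assume "gl b z \<noteq> g z"
    define W where "W = {x\<in>B b \<inter> B z. gl b x - gl z x \<noteq> 0}"
    have "line_holomorphic_on (\<lambda>x. gl b x - gl z x) (B b \<inter> B z)"
      by (intro line_holomorphic_on_diff line_holomorphic_on_subset[OF gl])
        (use openB in \<open>auto simp flip: B_def\<close>)
    then have "open W"
      unfolding W_def by (rule line_holomorphic_open_nonzero)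
    moreover have "z \<in> W"
      using z center \<open>gl b z \<noteq> g z\<close> by (simp add: W_def g_def)
    ultimately obtain y where "y \<in> W \<inter> G b \<inter> G z"
      using meets2[of W b z] by (auto simp: W_def)
    then show False
      using G(2)[of y b] G(2)[of y z] by (simp add: W_def)
  qed
  have gG: "g y = (\<Prod>w\<in>fibre y. w)" if "y \<in> G b" for y b
    using G(2)[OF that] g_eq[of y b] that by (simp add: G_def)
  have hol: "line_holomorphic_on g UNIV"
  proof (rule line_holomorphic_on_local)
    fix b
    have "line_holomorphic_on g (B b)"
      by (rule line_holomorphic_on_cong[OF gl[of b, folded B_def] g_eq])
    then show "\<exists>V. b \<in> V \<and> line_holomorphic_on g V"
      using center by blast
  qed simp
  have cont: "continuous_on UNIV g"
    by (rule line_holomorphic_onD[OF hol])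
  \<comment> \<open>A violation would persist on an open set by continuity and so reach a generic
    point, where \<open>g\<close> is the product over a fibre.\<close>
  have bound: "norm (g z) \<le> (C * (1 + norm z)) ^ n" for z
  proof (rule ccontr)
    assume z: "\<not> norm (g z) \<le> (C * (1 + norm z)) ^ n"
    define W where "W = {x. (C * (1 + norm x)) ^ n < norm (g x)}"
    have "open W"
      unfolding W_def by (intro open_Collect_less continuous_intros cont)
    moreover have "z \<in> W"
      using z by (simp add: W_def)
    ultimately obtain y where "y \<in> W" "y \<in> G z"
      using meets[of W z] center by blast
    then show False
      using norm_prod_fibre_le[of y] gG[of y z] Gn[of y z] by (simp add: W_def)
  qed
  \<comment> \<open>If \<open>g\<close> were nonzero at \<open>p\<close>, it would be nonzero at
    some regular point \<open>q\<close>. All lines over base points near \<open>q\<close> meet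
    \<open>X\<close> at tiny parameters, so generic fibre products near \<open>q\<close> have a tiny
    factor while the others stay bounded.\<close>
  have X_zero: "g p = 0" if p: "p \<in> X" for p
  proof (rule ccontr)
    assume "g p \<noteq> 0"
    have "open {z. g z \<noteq> 0}"
      by (intro open_Collect_neq continuous_intros cont)
    then obtain q where q: "g q \<noteq> 0" "regular_point (CARD('n) - 1) X q"
      using regular_dense[OF p] \<open>g p \<noteq> 0\<close> unfolding regular_dims_near_def by blast
    \<comment> \<open>Bounds the parameters of all fibres over \<open>ball q 1\<close>. Since
      \<open>K \<ge> 1\<close>, the remaining factors have product at most \<open>K ^ n\<close>;
      dividing \<open>\<eta>\<close> by it fixes how small the tiny factor must be.\<close>
    define K where "K = max 1 (\<bar>C\<bar> * (2 + norm q))"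
    define \<eta> where "\<eta> = norm (g q) / 2"
    have "\<eta> > 0" "K \<ge> 1"
      using q by (auto simp: \<eta>_def K_def)
    define \<epsilon> where "\<epsilon> = \<eta> / K ^ n"
    have "\<epsilon> > 0"
      using \<open>\<eta> > 0\<close> \<open>K \<ge> 1\<close> by (simp add: \<epsilon>_def)
    obtain \<delta> where \<delta>: "\<delta> > 0" "\<And>y. y \<in> ball q \<delta> \<Longrightarrow> \<exists>s. norm s < \<epsilon> \<and> y + s *s v \<in> X"
      using projection_open_at_regular_point[OF q(2) \<open>\<epsilon> > 0\<close>] by blast
    define W where "W = ball q \<delta> \<inter> ball q 1 \<inter> {x. \<eta> < norm (g x)}"
    have "open W"
      unfolding W_def by (intro open_Int open_ball open_Collect_less continuous_intros cont)
    moreover have "q \<in> W"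
      using \<delta> q by (simp add: W_def \<eta>_def)
    ultimately obtain y where y: "y \<in> W" "y \<in> G q"
      using meets[of W q] center by blast
    then obtain s where s: "norm s < \<epsilon>" "s \<in> fibre y"
      using \<delta>(2)[of y] by (auto simp: W_def fibre_def)
    have w_le: "norm w \<le> K" if "w \<in> fibre y" for w
    proof -
      have "norm y \<le> norm q + 1"
        using y norm_triangle_ineq2[of y q] by (simp add: W_def dist_norm norm_minus_commute)
      then have "\<bar>C\<bar> * (1 + norm y) \<le> K"
        unfolding K_def by (intro max.coboundedI2 mult_left_mono) auto
      moreover have "norm w \<le> C * (1 + norm y)"
        using that by (intro fibre_bound) (simp add: fibre_def)
      moreover have "C * (1 + norm y) \<le> \<bar>C\<bar> * (1 + norm y)"
        by (intro mult_right_mono) auto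
      ultimately show ?thesis by simp
    qed
    have "norm (g y) = norm s * norm (\<Prod>w\<in>fibre y - {s}. w)"
      using gG[OF y(2)] prod.remove[OF finite_fibre s(2), of "\<lambda>w. w"] by (simp add: norm_mult)
    also have "norm (\<Prod>w\<in>fibre y - {s}. w) \<le> K ^ card (fibre y - {s})"
      unfolding prod_norm[symmetric] prod_constant[symmetric] by (intro prod_mono) (use w_le in auto)
    also have "\<dots> \<le> K ^ n"
      using \<open>K \<ge> 1\<close> Gn[OF y(2)] card_Diff1_le[of "fibre y" s] by (intro power_increasing) auto
    finally have "norm (g y) \<le> norm s * K ^ n"
      by (simp add: mult_left_mono)
    also have "\<dots> \<le> \<epsilon> * K ^ n"
      using s \<open>K \<ge> 1\<close> by (intro mult_right_mono) auto
    also have "\<dots> = \<eta>"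
      using \<open>K \<ge> 1\<close> by (simp add: \<epsilon>_def)
    finally show False
      using y by (simp add: W_def)
  qed
  \<comment> \<open>Off \<open>X\<close> all parameters of nearby fibres have modulus above some
    \<open>\<epsilon>\<close>, so \<open>g\<close> has modulus at least
    \<open>\<epsilon> ^ n\<close> at generic points near \<open>z\<close>, which is incompatible
    with a zero at \<open>z\<close>.\<close>
  have zero_X: "z \<in> X" if z: "g z = 0" for z
  proof (rule ccontr)
    assume "z \<notin> X"
    then have "0 \<in> - fibre z" "open (- fibre z)"
      using closed_fibre by (auto simp: fibre_def)
    then obtain \<epsilon> where \<epsilon>: "\<epsilon> > 0" "cball 0 \<epsilon> \<subseteq> - fibre z"
      using open_contains_cball by meson
    have out: "z + w *s v \<in> - X" if "w \<in> cball 0 \<epsilon>" for w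
      using \<epsilon>(2) that by (auto simp: fibre_def)
    obtain r where r: "r > 0" "\<And>y w. y \<in> ball z r \<Longrightarrow> w \<in> cball 0 \<epsilon> \<Longrightarrow> y + w *s v \<in> - X"
      by (rule line_tube[OF open_Compl[OF closed_X] compact_cball out]) blast+
    define W where "W = ball z r \<inter> {x. norm (g x) < \<epsilon> ^ n}"
    have "open W"
      unfolding W_def by (intro open_Int open_ball open_Collect_less continuous_intros cont)
    moreover have "z \<in> W"
      using r z \<epsilon> by (simp add: W_def)
    ultimately obtain y where y: "y \<in> W" "y \<in> G z"
      using meets[of W z] center by blast
    have "\<epsilon> ^ card (fibre y) \<le> norm (\<Prod>w\<in>fibre y. w)"
      unfolding prod_norm[symmetric] prod_constant[symmetric]
    proof (rule prod_mono)
      fix w assume "w \<in> fibre y"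
      then have "w \<notin> cball 0 \<epsilon>"
        using r(2)[of y w] y by (auto simp: W_def fibre_def)
      then show "0 \<le> \<epsilon> \<and> \<epsilon> \<le> norm w"
        using \<epsilon> by simp
    qed
    then show False
      using y gG[OF y(2)] Gn[OF y(2)] by (simp add: W_def)
  qed
  show ?thesis
    by (rule that[OF hol bound]) (use X_zero zero_X in blast)
qed

end

section \<open>From a missing direction to bounded fibres\<close>

text \<open>If no constant works, there are points of \<open>X\<close> whose component along
  \<open>u\<close> dominates \<open>z\<close> by arbitrarily large factors. Rescaled by
  \<open>norm w\<close>, a subsequence converges to a unimodular multiple of \<open>u\<close>, which
  then lies in the tangent cone.\<close>

lemma bounded_fibres_if_not_asymptotic:
  fixes X :: "(complex ^ 'n) set"
  assumes "u \<noteq> 0" "vec.span {u} \<notin> asymptotic_directions X"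
  obtains C where "C \<ge> 0" "\<And>z w. z + w *s u \<in> X \<Longrightarrow> norm w \<le> C * (1 + norm z)"
proof -
  \<comment> \<open>The phase of the limit cannot be prescribed, so every nonzero complex multiple
    of \<open>u\<close> has to be excluded; all of them span the same point of projective
    space.\<close>
  have not_cone: "c *s u \<notin> tangent_cone_infinity X" if "c \<noteq> 0" for c
  proof
    assume "c *s u \<in> tangent_cone_infinity X"
    moreover have "c *s u \<noteq> 0"
      using that \<open>u \<noteq> 0\<close> by (simp add: vec_eq_iff)
    moreover have "vec.span {c *s u} = vec.span {u}"
    proof -
      have "k *s u = (k / c) *s (c *s u)" for k
        using that by (simp add: vector_smult_assoc)
      then have "range (\<lambda>k. k *s u) \<subseteq> range (\<lambda>k. k *s (c *s u))"
        by (intro image_subsetI range_eqI)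
      moreover have "range (\<lambda>k. k *s (c *s u)) \<subseteq> range (\<lambda>k. k *s u)"
        by (auto simp: vector_smult_assoc)
      ultimately show ?thesis
        by (simp add: vec.span_singleton)
    qed
    ultimately show False
      using assms(2) unfolding asymptotic_directions_def by blast
  qed
  have "\<exists>C\<ge>0. \<forall>z w. z + w *s u \<in> X \<longrightarrow> norm w \<le> C * (1 + norm z)"
  proof (rule ccontr)
    assume n: "\<not> (\<exists>C\<ge>0. \<forall>z w. z + w *s u \<in> X \<longrightarrow> norm w \<le> C * (1 + norm z))"
    have "\<exists>z w. z + w *s u \<in> X \<and> real k * (1 + norm z) < norm w" for k
      using n by (meson not_le of_nat_0_le_iff)
    then obtain z w where zw: "\<And>k. z k + w k *s u \<in> X" "\<And>k. real k * (1 + norm (z k)) < norm (w k)"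
      by metis
    have w_gt: "real k \<le> norm (w k)" for k
    proof -
      have "real k * 1 \<le> real k * (1 + norm (z k))"
        by (intro mult_left_mono) auto
      with zw(2)[of k] show ?thesis by linarith
    qed
    have w_pos: "norm (w k) > 0" for k
      using zw(2)[of k] by (meson add_nonneg_nonneg le_less_trans mult_nonneg_nonneg norm_ge_zero of_nat_0_le_iff zero_le_one)
    have unit: "\<forall>k. w k /\<^sub>R norm (w k) \<in> sphere 0 1"
      using w_pos by simp
    obtain c \<sigma> where c: "c \<in> sphere 0 1" "strict_mono \<sigma>" "((\<lambda>k. w k /\<^sub>R norm (w k)) \<circ> \<sigma>) \<longlonglongrightarrow> c"
      by (rule seq_compactE[OF compact_imp_seq_compact[OF compact_sphere] unit]) blast
    define x where "x k = z (\<sigma> k) + w (\<sigma> k) *s u" for k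
    define t where "t k = norm (w (\<sigma> k))" for k
    have t_pos: "t k > 0" for k
      using w_pos by (simp add: t_def)
    have t_ge: "real k \<le> t k" for k
      using w_gt[of "\<sigma> k"] seq_suble[OF c(2), of k] by (simp add: t_def)
    have t_top: "filterlim t at_top sequentially"
      by (rule filterlim_at_top_mono[OF filterlim_real_sequentially]) (simp add: t_ge)
    \<comment> \<open>The choice \<open>norm (w k) > k * (1 + norm (z k))\<close> makes the
      \<open>z\<close> part negligible after division by \<open>norm w\<close>.\<close>
    have z0: "(\<lambda>k. z (\<sigma> k) /\<^sub>R t k) \<longlonglongrightarrow> 0"
    proof (rule Lim_null_comparison)
      have "norm (z (\<sigma> k) /\<^sub>R t k) \<le> inverse (real k)" if "k > 0" for k
      proof -
        have "real k * norm (z (\<sigma> k)) \<le> real (\<sigma> k) * (1 + norm (z (\<sigma> k)))"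
          using seq_suble[OF c(2), of k] by (intro mult_mono) auto
        also have "\<dots> \<le> t k"
          using zw(2)[of "\<sigma> k"] by (simp add: t_def)
        finally show ?thesis
          using that t_pos[of k] by (simp add: divide_simps mult.commute)
      qed
      then show "\<forall>\<^sub>F k in sequentially. norm (z (\<sigma> k) /\<^sub>R t k) \<le> inverse (real k)"
        by (rule eventually_mono[OF eventually_gt_at_top[of 0]])
      show "(\<lambda>k. inverse (real k)) \<longlonglongrightarrow> 0"
        by (rule lim_inverse_n)
    qed
    have "(\<lambda>k. (w (\<sigma> k) /\<^sub>R t k) *s u) \<longlonglongrightarrow> c *s u"
      using c(3) by (intro bounded_bilinear.tendsto[OF bounded_bilinear_smult] tendsto_const)
        (simp add: comp_def t_def)
    then have "(\<lambda>k. z (\<sigma> k) /\<^sub>R t k + (w (\<sigma> k) /\<^sub>R t k) *s u) \<longlonglongrightarrow> 0 + c *s u"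
      by (intro tendsto_add z0)
    moreover have "x k /\<^sub>R t k = z (\<sigma> k) /\<^sub>R t k + (w (\<sigma> k) /\<^sub>R t k) *s u" for k
      by (simp add: x_def scaleR_right_distrib bounded_bilinear.scaleR_left[OF bounded_bilinear_smult])
    ultimately have lim: "(\<lambda>k. x k /\<^sub>R t k) \<longlonglongrightarrow> c *s u"
      by simp
    \<comment> \<open>As the rescaled limit is nonzero, \<open>norm (x k)\<close> grows in
      proportion to \<open>t k\<close>, which gives the divergence required by the tangent
      cone.\<close>
    have "norm (c *s u) > 0"
      using c \<open>u \<noteq> 0\<close> by (simp add: norm_smult)
    then have "filterlim (\<lambda>k. norm (x k /\<^sub>R t k) * t k) at_top sequentially"
      using tendsto_norm[OF lim] t_top by (intro filterlim_tendsto_pos_mult_at_top)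
    moreover have "norm (x k /\<^sub>R t k) * t k = norm (x k)" for k
      using t_pos[of k] by simp
    ultimately have "filterlim (\<lambda>k. norm (x k)) at_top sequentially"
      by (simp only:)
    moreover have "x k \<in> X" for k
      unfolding x_def by (rule zw)
    ultimately have "c *s u \<in> tangent_cone_infinity X"
      unfolding tangent_cone_infinity_def using t_pos t_top lim by blast
    moreover have "c \<noteq> 0"
      using c(1) by auto
    ultimately show False
      using not_cone by blast
  qed
  with that show ?thesis by blast
qed

theorem corollary3p4:
  fixes X :: "(complex ^ 'n) set"
  assumes "closed_pure_dim_analytic (CARD('n) - 1) X"
  shows "(algebraic_subset X \<or> asymptotic_directions X = projective_space) \<and>
         (asymptotic_directions X \<noteq> projective_space \<longrightarrow> algebraic_subset X)"
proof -
  have "algebraic_subset X" if "asymptotic_directions X \<noteq> projective_space"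
  proof -
    have "asymptotic_directions X \<subseteq> projective_space"
      unfolding asymptotic_directions_def projective_space_def by blast
    with that obtain u where u: "u \<noteq> 0" "vec.span {u} \<notin> asymptotic_directions X"
      unfolding projective_space_def by blast
    obtain C where C: "C \<ge> 0" "\<And>z w. z + w *s u \<in> X \<Longrightarrow> norm w \<le> C * (1 + norm z)"
      by (rule bounded_fibres_if_not_asymptotic[OF u]) blast
    interpret bounded_fibre_hypersurface X u C
      using assms C(2) unfolding closed_pure_dim_analytic_def has_dimension_at_def
      by unfold_locales auto
    obtain g N where g: "line_holomorphic_on g UNIV" "\<And>z. norm (g z) \<le> (C * (1 + norm z)) ^ N"
      "X = {z. g z = 0}"
      by (rule global_defining_function) blast
    have "polynomial_fun g"
      by (rule polynomial_fun_of_polynomial_growth[OF g(1,2) C(1)])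
    then obtain P where "\<And>z. g z = mpoly_eval P z"
      unfolding polynomial_fun_def by blast
    then show ?thesis
      unfolding algebraic_subset_def using g(3) by (intro exI[of _ "{P}"]) simp
  qed
  then show ?thesis by blast
qed

end
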